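(* (i) [Random walk] Let $k$ be a positive integer. For $p\in(0,1)$ let $\{S_n^p : n\geqslant 0\}$ be the simple random walk on $\mathbb{Z}$ with $S_0^p=0$ and i.i.d. steps distributed as $X$ with $\mathbb{P}(X=1)=p$, $\mathbb{P}(X=-1)=1-p$, and let $\sigma_p^k=\inf\{n : S_n^p=\pm k\}$. Then for any fixed $n\in\mathbb{N}$ the function $$(0,1)\ni p\mapsto \mathbb{P}(\sigma_p^k>n)$$ is increasing on $(0,1/2]$ and decreasing on $[1/2,1)$. (ii) [Brownian motion] Let $B_t$ denote the standard one-dimensional Brownian motion (started at $0$). Given $\lambda\in\mathbb{R}$ and $b>0$, define $$\tau_\lambda^b=\inf\{t : B_t+\lambda t\notin(-b,b)\}.$$ Then for any fixed $b>0$ and $t>0$, the function $$\lambda\mapsto\mathbb{P}(\tau_\lambda^b>t)$$ is decreasing in $\lambda$ on $[0,\infty)$.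
   Context: "Increasing" and "decreasing" are understood in the non-strict sense (non-decreasing, respectively non-increasing). *)

theory Defs
  imports "HOL-Probability.Probability" "HOL-Library.Extended_Nat"
begin

definition simple_random_walk :: "'a measure \<Rightarrow> real \<Rightarrow> (nat \<Rightarrow> 'a \<Rightarrow> int) \<Rightarrow> bool" where
  "simple_random_walk M p S \<longleftrightarrow>
     prob_space M \<and>
     (\<forall>\<omega>\<in>space M. S 0 \<omega> = 0) \<and>
     prob_space.indep_vars M (\<lambda>_. count_space UNIV) (\<lambda>i \<omega>. S (Suc i) \<omega> - S i \<omega>) UNIV \<and>
     (\<forall>i. measure M {\<omega> \<in> space M. S (Suc i) \<omega> - S i \<omega> = 1} = p \<and>
          measure M {\<omega> \<in> space M. S (Suc i) \<omega> - S i \<omega> = - 1} = 1 - p)"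

text \<open>The infimum is taken in \<^typ>\<open>enat\<close>, so it is \<open>\<infinity>\<close> if the walk never hits \<open>\<plusminus>k\<close>.\<close>

definition walk_hitting_time :: "(nat \<Rightarrow> 'a \<Rightarrow> int) \<Rightarrow> nat \<Rightarrow> 'a \<Rightarrow> enat" where
  "walk_hitting_time S k \<omega> = Inf (enat ` {n. S n \<omega> = int k \<or> S n \<omega> = - int k})"

text \<open>
  The index set of the process is \<open>[0, \<infinity>)\<close>; values at negative times are irrelevant.
  The start at 0 and the continuity of paths are only required almost surely.
\<close>

definition standard_brownian_motion :: "'a measure \<Rightarrow> (real \<Rightarrow> 'a \<Rightarrow> real) \<Rightarrow> bool" where
  "standard_brownian_motion M B \<longleftrightarrow>
     prob_space M \<and>
     (\<forall>t\<ge>0. B t \<in> borel_measurable M) \<and>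
     (AE \<omega> in M. B 0 \<omega> = 0) \<and>
     (\<forall>(n::nat) (u :: nat \<Rightarrow> real). 0 \<le> u 0 \<longrightarrow> mono u \<longrightarrow>
        prob_space.indep_vars M (\<lambda>_. borel) (\<lambda>i \<omega>. B (u (Suc i)) \<omega> - B (u i) \<omega>) {..<n}) \<and>
     (\<forall>s t. 0 \<le> s \<longrightarrow> s < t \<longrightarrow>
        distributed M lborel (\<lambda>\<omega>. B t \<omega> - B s \<omega>) (normal_density 0 (sqrt (t - s)))) \<and>
     (AE \<omega> in M. continuous_on {0..} (\<lambda>t. B t \<omega>))"

text \<open>The infimum is taken in \<^typ>\<open>ereal\<close>, so it is \<open>\<infinity>\<close> if there is no exit.\<close>

definition drift_exit_time :: "(real \<Rightarrow> 'a \<Rightarrow> real) \<Rightarrow> real \<Rightarrow> real \<Rightarrow> 'a \<Rightarrow> ereal" where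
  "drift_exit_time B l b \<omega> = Inf (ereal ` {s. 0 \<le> s \<and> B s \<omega> + l * s \<notin> {-b<..<b}})"

text \<open>
  Since paths are continuous only almost surely, the event that the exit time exceeds \<open>t\<close>
  belongs to \<^term>\<open>sets M\<close> only up to a null set. Its probability is therefore taken in the
  completion, which agrees with \<^term>\<open>M\<close> on \<^term>\<open>sets M\<close>.
\<close>

definition exit_survival :: "'a measure \<Rightarrow> (real \<Rightarrow> 'a \<Rightarrow> real) \<Rightarrow> real \<Rightarrow> real \<Rightarrow> real \<Rightarrow> real" where
  "exit_survival M B b t l =
     measure (completion M) {\<omega> \<in> space M. drift_exit_time B l b \<omega> > ereal t}"

end

theory Submission imports Defs begin

text \<open>
  In both parts the absolute value of the process is a Markov chain whose transition law depends
  monotonically on the drift. For the simple walk this gives a recursion for the survival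
  probability in terms of \<open>\<bar>S\<^sub>n\<bar>\<close>, in which the probability of an outward step increases with
  \<open>\<bar>p - 1/2\<bar>\<close>. Brownian motion is observed on dyadic grids; the transition density of the absolute
  value of the Gaussian walk obtained in this way has a monotone likelihood ratio both in the
  drift and in the starting point, so that the survival probability of the walk decreases in both.
  The monotonicity in the drift survives the limit of fine grids.
\<close>

subsection \<open>Killed random walks\<close>

text \<open>The obstacle is that drift pushes the path away from one end of the interval and towards
  the other, so the natural coupling of two signed paths with different drifts does not order their
  exit times. Folding at the origin leaves a single end. The folded process is Markov because the
  start is 0: given the past of the absolute value, the sign then has odds p^x : (1 - p)^x,
  respectively exp(l x) : exp(-l x). Hence signed survival functions enter through sums over x and
  -x with these weights.

  Comparing two drifts by induction on the number of steps requires monotonicity in the starting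
  point as well: a larger drift sends more mass outward, and this lowers survival once survival is
  known to decrease outward. A Brownian path sampled on a grid is exactly a Gaussian walk, so the
  passage to the limit involves monotone sequences of events and no weak convergence.\<close>

definition killed_step :: "'b measure \<Rightarrow> 'b::comm_monoid_add set \<Rightarrow> ('b \<Rightarrow> ennreal) \<Rightarrow> 'b \<Rightarrow> ennreal" where
  "killed_step \<nu> A f x = (\<integral>\<^sup>+ y. indicator A (x + y) * f (x + y) \<partial>\<nu>)"

lemma measurable_sum_PiM:
  fixes N :: "'b::comm_monoid_add measure" and i n :: nat
  assumes N: "space N = UNIV" and add: "(\<lambda>z. fst z + snd z) \<in> N \<Otimes>\<^sub>M N \<rightarrow>\<^sub>M N"
    and "i \<le> n"
  shows "(\<lambda>g. \<Sum>j<i. g j) \<in> (\<Pi>\<^sub>M j\<in>{..<n}. N) \<rightarrow>\<^sub>M N"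
  using assms(3)
proof (induction i)
  case 0
  then show ?case by (simp add: N)
next
  case (Suc i)
  have "(\<lambda>g. g i) \<in> (\<Pi>\<^sub>M j\<in>{..<n}. N) \<rightarrow>\<^sub>M N"
    using Suc.prems by (intro measurable_component_singleton) auto
  then have "(\<lambda>g. (\<Sum>j<i. g j, g i)) \<in> (\<Pi>\<^sub>M j\<in>{..<n}. N) \<rightarrow>\<^sub>M N \<Otimes>\<^sub>M N"
    using Suc by (intro measurable_Pair) auto
  from measurable_compose[OF this add] show ?case by simp
qed

text \<open>The last increment is independent of the earlier ones, and integrating it out replaces
  \<open>f\<close> by \<open>killed_step \<nu> A f\<close>; the induction therefore runs over
  arbitrary terminal functions \<open>f\<close>. Since \<open>killed_step\<close> tests only the
  point after a step, the start is tested separately by \<open>indicator A 0\<close>. Integer and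
  real walks are both instances.\<close>

lemma (in prob_space) nn_integral_killed_walk:
  fixes N :: "'b::comm_monoid_add measure"
  assumes N: "space N = UNIV" and add: "(\<lambda>z. fst z + snd z) \<in> N \<Otimes>\<^sub>M N \<rightarrow>\<^sub>M N"
    and A: "A \<in> sets N"
    and indep: "indep_vars (\<lambda>_. N) Y {..<n}"
    and distr: "\<And>i. i < n \<Longrightarrow> distr M N (Y i) = \<nu>"
    and f: "f \<in> borel_measurable N"
  shows "(\<integral>\<^sup>+\<omega>. (\<Prod>i\<le>n. indicator A (\<Sum>j<i. Y j \<omega>)) * f (\<Sum>j<n. Y j \<omega>) \<partial>M)
    = indicator A 0 * (killed_step \<nu> A ^^ n) f 0"
  using indep distr f
proof (induction n arbitrary: f)
  case 0
  then show ?case by (simp add: emeasure_space_1)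
next
  case (Suc n)
  have Yn: "Y n \<in> M \<rightarrow>\<^sub>M N"
    using Suc.prems(1) by (auto simp: indep_vars_def)
  have Y: "Y i \<in> M \<rightarrow>\<^sub>M N" if "i < n" for i
    using that Suc.prems(1) by (auto simp: indep_vars_def)
  have nu: "\<nu> = distr M N (Y n)" using Suc.prems(2)[of n] by simp
  interpret \<nu>: prob_space \<nu> unfolding nu by (rule prob_space_distr[OF Yn])
  have sets_nu: "sets \<nu> = sets N" by (simp add: nu)
  \<comment> \<open>The past and the last increment become two single random variables
    \<open>R\<close> and \<open>Z\<close> on product spaces, the form in which independence
    factorises their joint law; \<open>Z\<close> has the one-point index set
    \<open>{n}\<close>.\<close>
  define R where "R = (\<lambda>\<omega>. restrict (\<lambda>i. Y i \<omega>) {..<n})"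
  let ?P = "\<Pi>\<^sub>M j\<in>{..<n}. N"
  have R: "R \<in> M \<rightarrow>\<^sub>M ?P"
    unfolding R_def using Y by (intro measurable_restrict) auto
  have ind: "indep_var ?P R (\<Pi>\<^sub>M j\<in>{n}. N) (\<lambda>\<omega>. restrict (\<lambda>i. Y i \<omega>) {n})"
    unfolding R_def using Suc.prems(1)
    by (intro indep_var_restrict[where I="{..<Suc n}"]) auto
  let ?Pn = "\<Pi>\<^sub>M j\<in>{n}. N"
  define Z where "Z = (\<lambda>\<omega>. restrict (\<lambda>i. Y i \<omega>) {n})"
  have Z: "Z \<in> M \<rightarrow>\<^sub>M ?Pn"
    unfolding Z_def using Yn by (intro measurable_restrict) auto
  have prod: "distr M (?P \<Otimes>\<^sub>M ?Pn) (\<lambda>\<omega>. (R \<omega>, Z \<omega>)) = distr M ?P R \<Otimes>\<^sub>M distr M ?Pn Z"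
    using indep_var_distribution_eq[THEN iffD1, OF ind] by (simp add: Z_def)
  interpret Zd: prob_space "distr M ?Pn Z" by (rule prob_space_distr[OF Z])
  define K where "K = (\<lambda>g y. (\<Prod>i\<le>n. indicator A (\<Sum>j<i. g j)) *
     (indicator A ((\<Sum>j<n. g j) + y) * f ((\<Sum>j<n. g j) + y)) :: ennreal)"
  have S: "(\<lambda>g. \<Sum>j<i. g j) \<in> ?P \<rightarrow>\<^sub>M N" if "i \<le> n" for i
    using measurable_sum_PiM[OF N add that] .
  have S': "(\<lambda>z. (\<Sum>j<n. fst z j) + snd z) \<in> ?P \<Otimes>\<^sub>M N \<rightarrow>\<^sub>M N"
  proof -
    have "(\<lambda>z. (\<Sum>j<n. fst z j, snd z)) \<in> ?P \<Otimes>\<^sub>M N \<rightarrow>\<^sub>M N \<Otimes>\<^sub>M N"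
      using measurable_compose[OF measurable_fst S] by (intro measurable_Pair) auto
    from measurable_compose[OF this add] show ?thesis by simp
  qed
  have iA: "indicator A \<in> borel_measurable N" using A by (rule borel_measurable_indicator)
  have K: "(\<lambda>z. K (fst z) (snd z)) \<in> borel_measurable (?P \<Otimes>\<^sub>M N)"
    unfolding K_def
    by (intro borel_measurable_times_ennreal borel_measurable_prod_ennreal
        measurable_compose[OF S' iA] measurable_compose[OF S' Suc.prems(3)]
        measurable_compose[OF measurable_compose[OF measurable_fst S] iA]) auto
  have K': "(\<lambda>z. K (fst z) (snd z n)) \<in> borel_measurable (?P \<Otimes>\<^sub>M ?Pn)"
  proof -
    have "(\<lambda>z. (fst z, snd z n)) \<in> ?P \<Otimes>\<^sub>M ?Pn \<rightarrow>\<^sub>M ?P \<Otimes>\<^sub>M N"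
      using measurable_compose[OF measurable_snd measurable_component_singleton[of n "{n}" "\<lambda>_. N"]]
      by (intro measurable_Pair) auto
    from measurable_compose[OF this K] show ?thesis by simp
  qed
  have iAf: "(\<lambda>x. indicator A x * f x) \<in> borel_measurable N"
    using iA Suc.prems(3) by (rule borel_measurable_times_ennreal)
  have Sfst: "(\<lambda>z. fst z + snd z) \<in> N \<Otimes>\<^sub>M \<nu> \<rightarrow>\<^sub>M N"
    using add measurable_cong_sets[OF sets_pair_measure_cong[OF refl sets_nu] refl] by blast
  have Qf: "killed_step \<nu> A f \<in> borel_measurable N"
    unfolding killed_step_def 
    using measurable_compose[OF Sfst iAf]
    by (intro \<nu>.borel_measurable_nn_integral) (simp add: split_def)
  have sumR: "(\<Sum>j<i. R \<omega> j) = (\<Sum>j<i. Y j \<omega>)" if "i \<le> n" for i \<omega>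
    using that by (auto simp: R_def intro!: sum.cong)
  have "(\<integral>\<^sup>+\<omega>. (\<Prod>i\<le>Suc n. indicator A (\<Sum>j<i. Y j \<omega>)) * f (\<Sum>j<Suc n. Y j \<omega>) \<partial>M)
      = (\<integral>\<^sup>+\<omega>. K (R \<omega>) (Y n \<omega>) \<partial>M)"
    by (intro nn_integral_cong) (simp add: K_def sumR mult.assoc)
  also have "\<dots> = (\<integral>\<^sup>+z. K (fst z) (snd z n) \<partial>distr M (?P \<Otimes>\<^sub>M ?Pn) (\<lambda>\<omega>. (R \<omega>, Z \<omega>)))"
    using K' R Z by (subst nn_integral_distr) (auto simp: Z_def)
  also have "\<dots> = (\<integral>\<^sup>+g. \<integral>\<^sup>+h. K g (h n) \<partial>distr M ?Pn Z \<partial>distr M ?P R)"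
    unfolding prod using K'
    by (subst Zd.nn_integral_fst[symmetric]) (auto cong: measurable_cong_sets simp: split_def)
  also have "\<dots> = (\<integral>\<^sup>+g. \<integral>\<^sup>+y. K g y \<partial>\<nu> \<partial>distr M ?P R)"
  proof (intro nn_integral_cong)
    fix g assume "g \<in> space (distr M ?P R)"
    then have g: "g \<in> space ?P" by simp
    have Kg: "K g \<in> borel_measurable N"
      using measurable_compose[OF measurable_Pair1'[OF g] K] by simp
    have "(\<integral>\<^sup>+h. K g (h n) \<partial>distr M ?Pn Z) = (\<integral>\<^sup>+\<omega>. K g (Y n \<omega>) \<partial>M)"
      using Z measurable_compose[OF measurable_component_singleton[of n "{n}" "\<lambda>_. N"] Kg]
      by (subst nn_integral_distr) (auto simp: Z_def)
    also have "\<dots> = (\<integral>\<^sup>+y. K g y \<partial>\<nu>)"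
      unfolding nu using Yn Kg by (subst nn_integral_distr) auto
    finally show "(\<integral>\<^sup>+h. K g (h n) \<partial>distr M ?Pn Z) = (\<integral>\<^sup>+y. K g y \<partial>\<nu>)" .
  qed
  also have "\<dots> = (\<integral>\<^sup>+g. (\<Prod>i\<le>n. indicator A (\<Sum>j<i. g j)) * killed_step \<nu> A f (\<Sum>j<n. g j) \<partial>distr M ?P R)"
    unfolding K_def killed_step_def
  proof (intro nn_integral_cong nn_integral_cmult)
    fix g
    have "(\<lambda>y. (\<Sum>j<n. g j) + y) \<in> \<nu> \<rightarrow>\<^sub>M N"
      using measurable_compose[OF measurable_Pair1' Sfst, of "\<Sum>j<n. g j"] N by simp
    from measurable_compose[OF this iAf]
    show "(\<lambda>y. indicator A ((\<Sum>j<n. g j) + y) * f ((\<Sum>j<n. g j) + y)) \<in> borel_measurable \<nu>"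
      by simp
  qed
  also have "\<dots> = (\<integral>\<^sup>+\<omega>. (\<Prod>i\<le>n. indicator A (\<Sum>j<i. Y j \<omega>)) * killed_step \<nu> A f (\<Sum>j<n. Y j \<omega>) \<partial>M)"
    using R Qf measurable_compose[OF S iA] measurable_compose[OF S Qf]
    by (subst nn_integral_distr) (auto simp: sumR intro!: borel_measurable_prod_ennreal borel_measurable_times_ennreal)
  also have "\<dots> = indicator A 0 * (killed_step \<nu> A ^^ n) (killed_step \<nu> A f) 0"
    using Suc.prems Qf by (intro Suc.IH) (auto intro: indep_vars_subset)
  finally show ?case by (simp add: funpow_swap1)
qed

lemma (in prob_space) emeasure_killed_walk:
  fixes N :: "'b::comm_monoid_add measure"
  assumes N: "space N = UNIV" and add: "(\<lambda>z. fst z + snd z) \<in> N \<Otimes>\<^sub>M N \<rightarrow>\<^sub>M N"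
    and A: "A \<in> sets N"
    and indep: "indep_vars (\<lambda>_. N) Y {..<n}"
    and distr: "\<And>i. i < n \<Longrightarrow> distr M N (Y i) = \<nu>"
  shows "{\<omega>\<in>space M. \<forall>i\<le>n. (\<Sum>j<i. Y j \<omega>) \<in> A} \<in> sets M" (is "?E \<in> _")
    and "emeasure M {\<omega>\<in>space M. \<forall>i\<le>n. (\<Sum>j<i. Y j \<omega>) \<in> A}
    = indicator A 0 * (killed_step \<nu> A ^^ n) (\<lambda>_. 1) 0"
proof -
  have Y: "(\<lambda>\<omega>. restrict (\<lambda>i. Y i \<omega>) {..<n}) \<in> M \<rightarrow>\<^sub>M (\<Pi>\<^sub>M j\<in>{..<n}. N)"
    using indep by (intro measurable_restrict) (auto simp: indep_vars_def)
  have sums: "(\<lambda>\<omega>. \<Sum>j<i. Y j \<omega>) \<in> M \<rightarrow>\<^sub>M N" if "i \<le> n" for i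
  proof -
    have "(\<Sum>j<i. restrict (\<lambda>i. Y i \<omega>) {..<n} j) = (\<Sum>j<i. Y j \<omega>)" for \<omega>
      using that by (intro sum.cong) auto
    then show ?thesis
      using measurable_compose[OF Y measurable_sum_PiM[OF N add that]] by simp
  qed
  have "{\<omega>\<in>space M. (\<Sum>j<i. Y j \<omega>) \<in> A} \<in> sets M" if "i \<le> n" for i
    using measurable_sets[OF sums[OF that] A] by (simp add: vimage_def Int_def conj_commute)
  then have E: "?E \<in> sets M"
    using sets.sets_Collect_finite_All[of "{..n}" M "\<lambda>i \<omega>. (\<Sum>j<i. Y j \<omega>) \<in> A"]
    by (simp add: Ball_def)
  show "?E \<in> sets M" by (rule E)
  have "emeasure M ?E = (\<integral>\<^sup>+\<omega>. indicator ?E \<omega> \<partial>M)"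
    by (rule nn_integral_indicator[OF E, symmetric])
  also have "\<dots> = (\<integral>\<^sup>+\<omega>. (\<Prod>i\<le>n. indicator A (\<Sum>j<i. Y j \<omega>)) * 1 \<partial>M)"
  proof (intro nn_integral_cong)
    fix \<omega> assume "\<omega> \<in> space M"
    show "indicator ?E \<omega> = (\<Prod>i\<le>n. indicator A (\<Sum>j<i. Y j \<omega>)) * (1::ennreal)"
    proof (cases "\<forall>i\<le>n. (\<Sum>j<i. Y j \<omega>) \<in> A")
      case True
      then show ?thesis using \<open>\<omega> \<in> space M\<close> by simp
    next
      case False
      then have "(\<Prod>i\<le>n. indicator A (\<Sum>j<i. Y j \<omega>)) = (0::ennreal)"
        by (intro prod_zero) (auto simp: indicator_def)
      with False show ?thesis by simp
    qed
  qed
  also have "\<dots> = indicator A 0 * (killed_step \<nu> A ^^ n) (\<lambda>_. 1) 0"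
    using nn_integral_killed_walk[OF N add A indep distr, of "\<lambda>_. 1"] by simp
  finally show "emeasure M ?E = indicator A 0 * (killed_step \<nu> A ^^ n) (\<lambda>_. 1) 0" .
qed

subsection \<open>Simple random walk\<close>

text \<open>For positive \<open>x\<close> this is the mean of \<open>p\<close> and
  \<open>1 - p\<close> weighted by the odds \<open>p ^ x\<close> and \<open>(1 - p) ^ x\<close> of
  the sign. At 0 the same formula would give 1/2, whereas the absolute value must step to 1.\<close>

definition abs_walk_up :: "real \<Rightarrow> nat \<Rightarrow> real" where
  "abs_walk_up p x = (if x = 0 then 1 else (p ^ Suc x + (1 - p) ^ Suc x) / (p ^ x + (1 - p) ^ x))"

text \<open>The truncated \<open>x - 1\<close> at \<open>x = 0\<close> is harmless, since its weight
  \<open>1 - abs_walk_up p 0\<close> is 0.\<close>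

fun abs_walk_survival :: "real \<Rightarrow> nat \<Rightarrow> nat \<Rightarrow> nat \<Rightarrow> real" where
  "abs_walk_survival p k 0 x = (if x < k then 1 else 0)"
| "abs_walk_survival p k (Suc n) x = (if x < k then
     abs_walk_up p x * abs_walk_survival p k n (Suc x) +
     (1 - abs_walk_up p x) * abs_walk_survival p k n (x - 1) else 0)"

lemma abs_walk_up_bounds:
  assumes "0 < p" "p < 1"
  shows "0 \<le> abs_walk_up p x" "abs_walk_up p x \<le> 1"
proof -
  have c: "p ^ x + (1 - p) ^ x > 0" using assms by (simp add: add_pos_pos)
  have "p ^ Suc x \<le> p ^ x" "(1 - p) ^ Suc x \<le> (1 - p) ^ x"
    using assms by (auto simp: mult_le_cancel_right1)
  then have "p ^ Suc x + (1 - p) ^ Suc x \<le> p ^ x + (1 - p) ^ x" by (rule add_mono)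
  with c show "abs_walk_up p x \<le> 1" by (simp add: abs_walk_up_def del: power_Suc)
  show "0 \<le> abs_walk_up p x"
    using assms by (auto simp: abs_walk_up_def intro!: divide_nonneg_nonneg add_nonneg_nonneg)
qed

lemma abs_walk_survival_nonneg:
  assumes "0 < p" "p < 1"
  shows "0 \<le> abs_walk_survival p k n x"
  using abs_walk_up_bounds[OF assms]
  by (induction n arbitrary: x) (auto intro!: add_nonneg_nonneg mult_nonneg_nonneg)

lemma abs_walk_survival_symmetric: "abs_walk_survival (1 - p) k n x = abs_walk_survival p k n x"
proof -
  have "abs_walk_up (1 - p) = abs_walk_up p" by (auto simp: abs_walk_up_def add.commute)
  then show ?thesis by (induction n arbitrary: x) auto
qed

lemma convex_combination_bounds:
  fixes u a b :: real
  assumes "0 \<le> u" "u \<le> 1" "a \<le> b"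
  shows "a \<le> u * a + (1 - u) * b" "u * a + (1 - u) * b \<le> b"
  using mult_left_mono[OF assms(3), of u] mult_left_mono[OF assms(3), of "1 - u"] assms(1,2)
  by (simp_all add: algebra_simps)

text \<open>Steps of size two, because the walk preserves parity.\<close>

lemma abs_walk_survival_decreasing:
  assumes p: "0 < p" "p < 1"
  shows "abs_walk_survival p k n (x + 2) \<le> abs_walk_survival p k n x"
proof (induction n arbitrary: x)
  case 0
  then show ?case by simp
next
  case (Suc n)
  note u = abs_walk_up_bounds[OF p]
  show ?case
  proof (cases "x + 2 < k")
    case False
    then show ?thesis using abs_walk_survival_nonneg[OF p, of k "Suc n" x] by simp
  next
    case True
    \<comment> \<open>The value at the common neighbour \<open>Suc x\<close> separates the two
      sides: seen from \<open>x + 2\<close> it is the inward, better neighbour, seen from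
      \<open>x\<close> the outward, worse one.\<close>
    have "abs_walk_survival p k (Suc n) (x + 2) \<le> abs_walk_survival p k n (Suc x)"
      using convex_combination_bounds(2)[OF u Suc.IH[of "Suc x"], of "x + 2"] True by simp
    also have "\<dots> \<le> abs_walk_survival p k (Suc n) x"
    proof (cases x)
      case 0
      then show ?thesis using True by (simp add: abs_walk_up_def)
    next
      case (Suc y)
      then show ?thesis
        using convex_combination_bounds(1)[OF u Suc.IH[of y], of x] True by simp
    qed
    finally show ?thesis .
  qed
qed

text \<open>With \<open>s q\<close> the conditional probability of a positive sign, the outward
  probability is q s + (1 - q)(1 - s) = 1/2 + (2 q - 1)(s - 1/2). Both factors of the product are
  nonnegative and increasing in \<open>q\<close> on [1/2, 1).\<close>

lemma abs_walk_up_mono: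
  assumes p: "1/2 \<le> p" "p \<le> p'" "p' < 1"
  shows "abs_walk_up p x \<le> abs_walk_up p' x"
proof (cases "x = 0")
  case False
  define s where "s = (\<lambda>p::real. p ^ x / (p ^ x + (1 - p) ^ x))"
  have up: "abs_walk_up q x = 1/2 + (2 * q - 1) * (s q - 1/2)" if "1/2 \<le> q" "q < 1" for q
  proof -
    have "q ^ x + (1 - q) ^ x > 0" using that by (intro add_pos_pos zero_less_power) auto
    then show ?thesis using False by (simp add: abs_walk_up_def s_def field_simps)
  qed
  have half: "1/2 \<le> s q" if "1/2 \<le> q" "q < 1" for q
  proof -
    have "q ^ x + (1 - q) ^ x > 0" using that by (intro add_pos_pos zero_less_power) auto
    moreover have "(1 - q) ^ x \<le> q ^ x" using that by (intro power_mono) auto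
    ultimately show ?thesis by (simp add: s_def field_simps)
  qed
  have "s p \<le> s p'"
  proof -
    have "0 < p ^ x + (1 - p) ^ x" "0 < p' ^ x + (1 - p') ^ x"
      using p by (auto intro!: add_pos_pos zero_less_power)
    moreover have "p ^ x * (1 - p') ^ x \<le> p' ^ x * (1 - p) ^ x"
      using p by (intro mult_mono power_mono) auto
    ultimately show ?thesis by (simp add: s_def field_simps)
  qed
  then have "(2 * p - 1) * (s p - 1/2) \<le> (2 * p' - 1) * (s p' - 1/2)"
    using p half[of p] by (intro mult_mono) auto
  then show ?thesis using p by (simp add: up)
qed (simp add: abs_walk_up_def)

text \<open>The remaining survival function and the transition law are changed one after the other:
  the former by the induction hypothesis under the law for \<open>p'\<close>, the latter because
  shifting mass from \<open>x - 1\<close> to \<open>x + 1\<close> lowers the mean of a function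
  decreasing in steps of two.\<close>

lemma abs_walk_survival_antimono:
  assumes p: "1/2 \<le> p" "p \<le> p'" "p' < 1"
  shows "abs_walk_survival p' k n x \<le> abs_walk_survival p k n x"
proof (induction n arbitrary: x)
  case 0
  then show ?case by simp
next
  case (Suc n)
  have p01: "0 < p" "p < 1" and p01': "0 < p'" "p' < 1" using p by auto
  note u' = abs_walk_up_bounds[OF p01']
  have "abs_walk_up p' x * abs_walk_survival p' k n (Suc x) +
      (1 - abs_walk_up p' x) * abs_walk_survival p' k n (x - 1)
    \<le> abs_walk_up p' x * abs_walk_survival p k n (Suc x) +
      (1 - abs_walk_up p' x) * abs_walk_survival p k n (x - 1)"
    using u' Suc.IH by (intro add_mono mult_left_mono) auto
  also have "\<dots> \<le> abs_walk_up p x * abs_walk_survival p k n (Suc x) +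
      (1 - abs_walk_up p x) * abs_walk_survival p k n (x - 1)"
  proof (cases x)
    case 0
    then show ?thesis by (simp add: abs_walk_up_def)
  next
    case (Suc y)
    have "(abs_walk_up p' x - abs_walk_up p x) *
        (abs_walk_survival p k n (y + 2) - abs_walk_survival p k n y) \<le> 0"
      using abs_walk_up_mono[OF p, of x] abs_walk_survival_decreasing[OF p01, of k n y]
      by (intro mult_nonneg_nonpos) auto
    then show ?thesis using Suc by (simp add: algebra_simps)
  qed
  finally show ?case by simp
qed

section \<open>The signed walk and its hitting time\<close>

fun walk_survival :: "real \<Rightarrow> nat \<Rightarrow> nat \<Rightarrow> int \<Rightarrow> real" where
  "walk_survival p k 0 x = (if \<bar>x\<bar> < int k then 1 else 0)"
| "walk_survival p k (Suc n) x = (if \<bar>x\<bar> < int k then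
     p * walk_survival p k n (x + 1) + (1 - p) * walk_survival p k n (x - 1) else 0)"

text \<open>
  The absolute value of the walk is a Markov chain: given \<open>\<bar>S\<^sub>n\<bar> = x\<close>, the sign of \<open>S\<^sub>n\<close> is
  distributed in proportion to \<open>p\<^sup>x : (1 - p)\<^sup>x\<close>, independently of the past of \<open>\<bar>S\<bar>\<close>.
\<close>

lemma walk_survival_eq_abs_walk:
  assumes p: "0 < p" "p < 1"
  shows "p ^ x * walk_survival p k n (int x) + (1 - p) ^ x * walk_survival p k n (- int x)
    = (p ^ x + (1 - p) ^ x) * abs_walk_survival p k n x"
proof (induction n arbitrary: x)
  case 0
  then show ?case by (simp add: algebra_simps)
next
  case (Suc n)
  show ?case
  proof (cases "x < k")
    case False
    then show ?thesis by simp
  next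
    case True
    show ?thesis
    proof (cases x)
      case 0
      then show ?thesis using True Suc.IH[of 1] by (simp add: abs_walk_up_def)
    next
      case (Suc y)
      have c: "p ^ x + (1 - p) ^ x > 0" using p by (simp add: add_pos_pos)
      have up: "(p ^ x + (1 - p) ^ x) * abs_walk_up p x = p ^ Suc x + (1 - p) ^ Suc x"
        using c Suc by (simp add: abs_walk_up_def)
      \<comment> \<open>The inward terms \<open>p ^ x * (1 - p)\<close> and
        \<open>(1 - p) ^ x * p\<close> share the factor \<open>p * (1 - p)\<close> and leave the
        weights of level \<open>y\<close>, so the induction hypothesis applies to the inward terms
        as well as to the outward ones.\<close>
      have down: "(p ^ x + (1 - p) ^ x) * (1 - abs_walk_up p x) = p * (1 - p) * (p ^ y + (1 - p) ^ y)"
        unfolding right_diff_distrib up using Suc by (simp add: algebra_simps)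
      have "p ^ x * walk_survival p k (Suc n) (int x) + (1 - p) ^ x * walk_survival p k (Suc n) (- int x)
        = (p ^ Suc x * walk_survival p k n (int (Suc x)) + (1 - p) ^ Suc x * walk_survival p k n (- int (Suc x)))
        + p * (1 - p) * (p ^ y * walk_survival p k n (int y) + (1 - p) ^ y * walk_survival p k n (- int y))"
        using True Suc by (simp add: algebra_simps)
      also have "\<dots> = (p ^ x + (1 - p) ^ x) * abs_walk_up p x * abs_walk_survival p k n (Suc x)
        + (p ^ x + (1 - p) ^ x) * (1 - abs_walk_up p x) * abs_walk_survival p k n y"
        unfolding Suc.IH up down by (simp only: mult.assoc)
      also have "\<dots> = (p ^ x + (1 - p) ^ x) * abs_walk_survival p k (Suc n) x"
        using True Suc by (simp add: algebra_simps)
      finally show ?thesis .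
    qed
  qed
qed

lemma walk_survival_nonneg:
  assumes "0 < p" "p < 1"
  shows "0 \<le> walk_survival p k n x"
  using assms by (induction n arbitrary: x) auto

lemma walk_hitting_time_gt_iff:
  "walk_hitting_time S k \<omega> > enat n \<longleftrightarrow> (\<forall>i\<le>n. \<bar>S i \<omega>\<bar> \<noteq> int k)"
proof
  assume gt: "walk_hitting_time S k \<omega> > enat n"
  show "\<forall>i\<le>n. \<bar>S i \<omega>\<bar> \<noteq> int k"
  proof (intro allI impI notI)
    fix i assume i: "i \<le> n" "\<bar>S i \<omega>\<bar> = int k"
    then have "walk_hitting_time S k \<omega> \<le> enat i"
      unfolding walk_hitting_time_def by (intro Inf_lower) (auto simp: abs_if split: if_splits)
    also have "\<dots> \<le> enat n" using i(1) by simp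
    finally show False using gt by simp
  qed
next
  assume *: "\<forall>i\<le>n. \<bar>S i \<omega>\<bar> \<noteq> int k"
  have "enat (Suc n) \<le> walk_hitting_time S k \<omega>"
    unfolding walk_hitting_time_def
  proof (intro Inf_greatest, clarify)
    fix m assume "S m \<omega> = int k \<or> S m \<omega> = - int k"
    then have "\<bar>S m \<omega>\<bar> = int k" by auto
    with * have "\<not> m \<le> n" by auto
    then show "enat (Suc n) \<le> enat m" by simp
  qed
  then show "walk_hitting_time S k \<omega> > enat n"
    by (rule less_le_trans[rotated]) simp
qed

text \<open>Unit steps cannot jump over the levels \<open>k\<close> and \<open>-k\<close>, and
  \<open>k > 0\<close> puts the start strictly between them. This reconciles the hitting time, which
  sees only the two levels, with the survival recursion, which tests the whole interval.\<close>

lemma nearest_neighbour_path_confined_iff: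
  fixes s :: "nat \<Rightarrow> int"
  assumes "s 0 = 0" and steps: "\<And>i. s (Suc i) - s i \<in> {1, -1}" and "k > 0"
  shows "(\<forall>i\<le>n. \<bar>s i\<bar> \<noteq> int k) \<longleftrightarrow> (\<forall>i\<le>n. \<bar>s i\<bar> < int k)"
proof
  assume *: "\<forall>i\<le>n. \<bar>s i\<bar> \<noteq> int k"
  have "i \<le> n \<Longrightarrow> \<bar>s i\<bar> < int k" for i
  proof (induction i)
    case 0
    then show ?case using assms by simp
  next
    case (Suc i)
    then have "\<bar>s i\<bar> < int k" "\<bar>s (Suc i)\<bar> \<noteq> int k" using * by auto
    with steps[of i] show ?case by auto
  qed
  then show "\<forall>i\<le>n. \<bar>s i\<bar> < int k" by blast
qed auto

lemma walk_hitting_time_measure: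
  fixes S :: "nat \<Rightarrow> 'a \<Rightarrow> int"
  assumes S: "simple_random_walk M p S" and p: "0 < p" "p < 1" and k: "k > 0"
  shows "measure M {\<omega> \<in> space M. walk_hitting_time S k \<omega> > enat n} = abs_walk_survival p k n 0"
proof -
  interpret prob_space M using S by (simp add: simple_random_walk_def)
  define Y where "Y = (\<lambda>i \<omega>. S (Suc i) \<omega> - S i \<omega>)"
  define N where "N = (count_space UNIV :: int measure)"
  define A where "A = {x. \<bar>x\<bar> < int k}"
  have indep: "indep_vars (\<lambda>_. N) Y UNIV"
    using S by (simp add: simple_random_walk_def Y_def N_def)
  have Y: "Y i \<in> M \<rightarrow>\<^sub>M N" for i
    using indep by (auto simp: indep_vars_def)
  define U where "U = (\<lambda>i y. {\<omega> \<in> space M. Y i \<omega> = y})"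
  have U: "U i y \<in> sets M" for i y
    using measurable_sets[OF Y, of "{y}" i] by (simp add: N_def U_def vimage_def Int_def conj_commute)
  have prob1: "prob (U i 1) = p" "prob (U i (-1)) = 1 - p" for i
    using S unfolding simple_random_walk_def Y_def U_def by auto
  \<comment> \<open>The two prescribed masses add up to 1, so a step outside \<open>{1, -1}\<close>
    is a null event but not an impossible one; the path argument below works on a set of full
    measure.\<close>
  have AEstep: "AE \<omega> in M. Y i \<omega> \<in> {1, -1}" for i
  proof -
    have "prob (U i 1 \<union> U i (-1)) = 1"
      using U prob1 by (subst finite_measure_Union) (auto simp: U_def)
    then have "AE \<omega> in M. \<omega> \<in> U i 1 \<union> U i (-1)"
      by (rule AE_prob_1)
    then show ?thesis by eventually_elim (auto simp: U_def)
  qed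
  have dint: "(\<integral>\<^sup>+y. f y \<partial>distr M N (Y i)) = p * f 1 + (1 - p) * f (-1)" for f :: "int \<Rightarrow> ennreal" and i
  proof -
    have "(\<integral>\<^sup>+y. f y \<partial>distr M N (Y i)) = (\<integral>\<^sup>+\<omega>. f (Y i \<omega>) \<partial>M)"
      using Y by (intro nn_integral_distr) (auto simp: N_def)
    also have "\<dots> = (\<integral>\<^sup>+\<omega>. f 1 * indicator (U i 1) \<omega> + f (-1) * indicator (U i (-1)) \<omega> \<partial>M)"
      using AEstep[of i] AE_space
      by (intro nn_integral_cong_AE, eventually_elim) (auto simp: U_def)
    also have "\<dots> = f 1 * emeasure M (U i 1) + f (-1) * emeasure M (U i (-1))"
      using U by (subst nn_integral_add) (auto simp: nn_integral_cmult_indicator)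
    finally show ?thesis
      by (simp add: emeasure_eq_measure prob1 mult.commute)
  qed
  define \<nu> where "\<nu> = distr M N (Y 0)"
  have distr: "distr M N (Y i) = \<nu>" for i
    unfolding \<nu>_def
  proof (rule measure_eqI)
    fix X assume "X \<in> sets (distr M N (Y i))"
    then show "emeasure (distr M N (Y i)) X = emeasure (distr M N (Y 0)) X"
      using dint[of i "indicator X"] dint[of 0 "indicator X"] by (simp add: N_def)
  qed simp
  have S0: "S 0 \<omega> = 0" if "\<omega> \<in> space M" for \<omega>
    using S that by (simp add: simple_random_walk_def)
  have sumY: "(\<Sum>j<i. Y j \<omega>) = S i \<omega>" if "\<omega> \<in> space M" for i \<omega>
    using S0[OF that] sum_lessThan_telescope[of "\<lambda>i. S i \<omega>" i] by (simp add: Y_def)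
  \<comment> \<open>\<open>walk_survival\<close> tests the current point while
    \<open>killed_step\<close> tests the next one; the extra indicator makes up for this
    difference.\<close>
  have G: "indicator A x * (killed_step \<nu> A ^^ n) (\<lambda>_. 1) x = ennreal (walk_survival p k n x)" for x n
  proof (induction n arbitrary: x)
    case 0
    then show ?case by (simp add: A_def)
  next
    case (Suc n)
    have "(killed_step \<nu> A ^^ Suc n) (\<lambda>_. 1) x
      = (\<integral>\<^sup>+y. ennreal (walk_survival p k n (x + y)) \<partial>\<nu>)"
      by (simp add: killed_step_def Suc.IH)
    also have "\<dots> = ennreal p * ennreal (walk_survival p k n (x + 1)) +
       ennreal (1 - p) * ennreal (walk_survival p k n (x - 1))"
      unfolding \<nu>_def dint by simp
    also have "\<dots> = ennreal (p * walk_survival p k n (x + 1) + (1 - p) * walk_survival p k n (x - 1))"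
      using p walk_survival_nonneg[OF p] by (simp add: ennreal_mult)
    finally show ?case by (simp add: A_def)
  qed
  have N: "space N = UNIV" "A \<in> sets N" by (auto simp: N_def)
  have ms: "(\<lambda>z. fst z + snd z) \<in> N \<Otimes>\<^sub>M N \<rightarrow>\<^sub>M N"
    by (simp add: N_def pair_measure_countable)
  note walk = emeasure_killed_walk[OF N(1) ms N(2) indep_vars_subset[OF indep] distr, of n, OF subset_UNIV]
  \<comment> \<open>The hypotheses give measurability of the increments only; the positions inherit
    it as their sums.\<close>
  have S_meas: "(\<lambda>\<omega>. \<Sum>j<i. Y j \<omega>) \<in> M \<rightarrow>\<^sub>M N" for i
  proof (induction i)
    case (Suc i)
    from measurable_compose[OF measurable_Pair[OF Suc Y] ms] show ?case by simp
  qed (simp add: N_def)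
  have SM: "{\<omega> \<in> space M. \<bar>S i \<omega>\<bar> \<noteq> int k} \<in> sets M" for i
  proof -
    have "{\<omega> \<in> space M. \<bar>S i \<omega>\<bar> \<noteq> int k} = (\<lambda>\<omega>. \<Sum>j<i. Y j \<omega>) -` {x. \<bar>x\<bar> \<noteq> int k} \<inter> space M"
      using sumY by auto
    also have "\<dots> \<in> sets M"
      by (rule measurable_sets[OF S_meas]) (simp add: N_def)
    finally show ?thesis .
  qed
  have "measure M {\<omega> \<in> space M. walk_hitting_time S k \<omega> > enat n}
    = measure M {\<omega> \<in> space M. \<forall>i\<le>n. (\<Sum>j<i. Y j \<omega>) \<in> A}"
  proof (rule measure_eq_AE)
    have "AE \<omega> in M. \<forall>i. Y i \<omega> \<in> {1, -1}"
      unfolding AE_all_countable using AEstep by blast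
    then show "AE \<omega> in M. (\<omega> \<in> {\<omega> \<in> space M. walk_hitting_time S k \<omega> > enat n}) =
        (\<omega> \<in> {\<omega> \<in> space M. \<forall>i\<le>n. (\<Sum>j<i. Y j \<omega>) \<in> A})"
    proof (eventually_elim)
      case (elim \<omega>)
      show ?case
      proof (cases "\<omega> \<in> space M")
        case True
        have "(\<forall>i\<le>n. \<bar>S i \<omega>\<bar> \<noteq> int k) \<longleftrightarrow> (\<forall>i\<le>n. \<bar>S i \<omega>\<bar> < int k)"
          using S0[OF True] elim k
          by (intro nearest_neighbour_path_confined_iff) (auto simp: Y_def)
        then show ?thesis
          using True sumY[OF True] by (simp add: walk_hitting_time_gt_iff A_def)
      qed simp
    qed
    show "{\<omega> \<in> space M. walk_hitting_time S k \<omega> > enat n} \<in> sets M"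
      using sets.sets_Collect_finite_All[of "{..n}" M "\<lambda>i \<omega>. \<bar>S i \<omega>\<bar> \<noteq> int k"] SM
      by (simp add: walk_hitting_time_gt_iff Ball_def)
    show "{\<omega> \<in> space M. \<forall>i\<le>n. (\<Sum>j<i. Y j \<omega>) \<in> A} \<in> sets M"
      by (rule walk(1))
  qed
  also have "\<dots> = enn2real (indicator A 0 * (killed_step \<nu> A ^^ n) (\<lambda>_. 1) 0)"
    unfolding measure_def walk(2) ..
  also have "\<dots> = walk_survival p k n 0"
    using walk_survival_nonneg[OF p] by (simp add: G)
  also have "\<dots> = abs_walk_survival p k n 0"
    using walk_survival_eq_abs_walk[OF p, of 0 k n] by simp
  finally show ?thesis .
qed

lemma walk_hitting_time_monotone:
  fixes k n :: nat and M :: "real \<Rightarrow> 'a measure" and S :: "real \<Rightarrow> nat \<Rightarrow> 'a \<Rightarrow> int"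
  assumes k: "k > 0" and S: "\<forall>p\<in>{0<..<1}. simple_random_walk (M p) p (S p)"
  defines "F \<equiv> \<lambda>p. measure (M p) {\<omega> \<in> space (M p). walk_hitting_time (S p) k \<omega> > enat n}"
  shows "mono_on {0<..1/2} F" and "antimono_on {1/2..<1} F"
proof -
  have F: "F p = abs_walk_survival p k n 0" if "0 < p" "p < 1" for p
    unfolding F_def using S that by (intro walk_hitting_time_measure[OF _ _ _ k]) auto
  show "antimono_on {1/2..<1} F"
    by (intro monotone_onI) (auto simp: F intro: abs_walk_survival_antimono)
  show "mono_on {0<..1/2} F"
  proof (intro monotone_onI)
    fix p p' :: real assume "p \<in> {0<..1/2}" "p' \<in> {0<..1/2}" "p \<le> p'"
    \<comment> \<open>Reflecting the walk replaces \<open>p\<close> by \<open>1 - p\<close>, which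
      maps (0, 1/2] to [1/2, 1) and reverses the order.\<close>
    then have "abs_walk_survival (1 - p) k n 0 \<le> abs_walk_survival (1 - p') k n 0"
      by (intro abs_walk_survival_antimono) auto
    with \<open>p \<in> _\<close> \<open>p' \<in> _\<close> show "F p \<le> F p'"
      by (simp add: F abs_walk_survival_symmetric)
  qed
qed

subsection \<open>Gaussian random walk\<close>

lemma integrable_mult_bounded:
  fixes F r :: "'a \<Rightarrow> real"
  assumes r: "integrable M r" and F: "F \<in> borel_measurable M" "\<And>y. 0 \<le> F y" "\<And>y. F y \<le> 1"
  shows "integrable M (\<lambda>y. F y * r y)"
proof (rule Bochner_Integration.integrable_bound[OF r])
  show "(\<lambda>y. F y * r y) \<in> borel_measurable M"
    using F(1) r by (intro borel_measurable_times) auto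
  show "AE y in M. norm (F y * r y) \<le> norm (r y)"
    using F(2,3) by (intro AE_I2) (auto simp: abs_mult mult_left_le_one_le)
qed

text \<open>As \<open>p\<close> and \<open>q\<close> have equal integrals, \<open>F\<close> may be
  replaced by \<open>F - c\<close> for any constant. A value \<open>c\<close> lying between those of
  \<open>F\<close> on \<open>p < q\<close> and those on \<open>q \<le> p\<close> makes
  \<open>(F - c) * (p - q)\<close> nonnegative everywhere.\<close>

lemma integral_le_single_crossing:
  fixes p q F :: "'a \<Rightarrow> real"
  assumes p: "integrable M p" and q: "integrable M q"
    and eq: "(\<integral>y. p y \<partial>M) = (\<integral>y. q y \<partial>M)"
    and F: "F \<in> borel_measurable M" "\<And>y. 0 \<le> F y" "\<And>y. F y \<le> 1"
    and crossing: "\<And>y z. q y \<le> p y \<Longrightarrow> p z < q z \<Longrightarrow> F z \<le> F y"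
  shows "(\<integral>y. F y * q y \<partial>M) \<le> (\<integral>y. F y * p y \<partial>M)"
proof -
  \<comment> \<open>Inserting 0 keeps the supremum meaningful when \<open>p < q\<close> never holds;
    it remains a lower bound for \<open>F\<close> on \<open>q \<le> p\<close> because
    \<open>F\<close> is nonnegative.\<close>
  define B where "B = insert 0 (F ` {z. p z < q z})"
  define c where "c = Sup B"
  have bdd: "bdd_above B" by (intro bdd_aboveI[of _ 1]) (auto simp: B_def F)
  have below: "F z \<le> c" if "p z < q z" for z
    unfolding c_def using that bdd by (intro cSup_upper) (auto simp: B_def)
  have above: "c \<le> F y" if "q y \<le> p y" for y
    unfolding c_def using that crossing F(2) by (intro cSup_least) (auto simp: B_def)
  have sign: "0 \<le> (F y - c) * (p y - q y)" for y
    using below[of y] above[of y]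
    by (cases "p y < q y") (auto intro: mult_nonpos_nonpos)
  have "0 \<le> (\<integral>y. (F y - c) * (p y - q y) \<partial>M)"
    using sign by (intro integral_nonneg_AE) auto
  also have "\<dots> = (\<integral>y. F y * p y - F y * q y - (c * p y - c * q y) \<partial>M)"
    by (simp add: algebra_simps)
  also have "\<dots> = (\<integral>y. F y * p y \<partial>M) - (\<integral>y. F y * q y \<partial>M)"
    using p q eq integrable_mult_bounded[OF p F] integrable_mult_bounded[OF q F] by simp
  finally show ?thesis by simp
qed

section \<open>Likelihood ratios of the folded Gaussian kernel\<close>

lemma cosh_mono_abs:
  fixes x y :: real
  assumes "\<bar>x\<bar> \<le> \<bar>y\<bar>"
  shows "cosh x \<le> cosh y"
  using assms cosh_real_nonneg_le_iff[of "\<bar>x\<bar>" "\<bar>y\<bar>"] by simp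

text \<open>Total positivity of order two: cosh(v y) / cosh(u y) increases with \<bar>y\<bar>.
  Products become sums of cosh, whose arguments are compared through the signs of (v - u)(y - z), (v
  + u)(y - z) and (v - u)(y + z).\<close>

lemma cosh_ratio_mono:
  fixes u v y z :: real
  assumes "\<bar>u\<bar> \<le> \<bar>v\<bar>" "\<bar>z\<bar> \<le> \<bar>y\<bar>"
  shows "cosh (v * z) * cosh (u * y) \<le> cosh (v * y) * cosh (u * z)"
proof -
  have prod: "cosh a * cosh b = (cosh (a + b) + cosh (a - b)) / 2" for a b :: real
    by (simp add: cosh_add cosh_diff)
  have ab: "cosh (a * b) = cosh (\<bar>a\<bar> * \<bar>b\<bar>)" for a b :: real
    using cosh_real_abs[of "a * b"] by (simp add: abs_mult)
  have main: "cosh (v * z) * cosh (u * y) \<le> cosh (v * y) * cosh (u * z)"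
    if "0 \<le> u" "u \<le> v" "0 \<le> z" "z \<le> y" for u v y z :: real
  proof -
    have nn: "0 \<le> u * y" "0 \<le> v * z" "0 \<le> v * y" "0 \<le> u * z" using that by auto
    have 1: "0 \<le> (v - u) * (y - z)" "0 \<le> (v + u) * (y - z)" "0 \<le> (v - u) * (y + z)"
      using that by auto
    have "\<bar>v * z + u * y\<bar> \<le> \<bar>v * y + u * z\<bar>" "\<bar>v * z - u * y\<bar> \<le> \<bar>v * y - u * z\<bar>"
      using nn 1 by (auto simp: algebra_simps abs_if)
    then show ?thesis
      unfolding prod by (intro divide_right_mono add_mono cosh_mono_abs) auto
  qed
  from main[of "\<bar>u\<bar>" "\<bar>v\<bar>" "\<bar>z\<bar>" "\<bar>y\<bar>"] assms show ?thesis
    unfolding ab[of v z] ab[of u y] ab[of v y] ab[of u z] by simp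
qed

text \<open>
  For a Gaussian walk with steps of mean \<open>l * \<sigma>\<^sup>2\<close> and variance \<open>\<sigma>\<^sup>2\<close>, the absolute value is a
  Markov chain. This is its transition density from \<open>\<bar>x\<bar>\<close>, extended to an even function on the
  line, in a form that is symmetric in the drift \<open>l\<close> and the rescaled starting point \<open>x / \<sigma>\<^sup>2\<close>.
\<close>

definition abs_gauss_density :: "real \<Rightarrow> real \<Rightarrow> real \<Rightarrow> real \<Rightarrow> real" where
  "abs_gauss_density \<sigma> l x y = exp (- x\<^sup>2 / (2 * \<sigma>\<^sup>2) - l\<^sup>2 * \<sigma>\<^sup>2 / 2) / cosh (l * x) *
     normal_density 0 \<sigma> y * (cosh (l * y) * cosh (x / \<sigma>\<^sup>2 * y))"

lemma normal_density_shift: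
  assumes "\<sigma> > 0"
  shows "normal_density x \<sigma> y = normal_density 0 \<sigma> y * exp (x / \<sigma>\<^sup>2 * y - x\<^sup>2 / (2 * \<sigma>\<^sup>2))"
  using assms
  by (simp add: normal_density_def exp_add[symmetric] power2_eq_square field_simps)

text \<open>Completing the square: an exponential weight shifts the mean, so drift can be traded for
  a weight. This is the one-step form of the Girsanov change of measure.\<close>

lemma exp_times_normal_density:
  assumes "\<sigma> > 0"
  shows "exp (l * y) * normal_density x \<sigma> y
    = exp (l * x + l\<^sup>2 * \<sigma>\<^sup>2 / 2) * normal_density (x + l * \<sigma>\<^sup>2) \<sigma> y"
proof -
  have "l * y + (x / \<sigma>\<^sup>2 * y - x\<^sup>2 / (2 * \<sigma>\<^sup>2)) = (l * x + l\<^sup>2 * \<sigma>\<^sup>2 / 2) +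
      ((x + l * \<sigma>\<^sup>2) / \<sigma>\<^sup>2 * y - (x + l * \<sigma>\<^sup>2)\<^sup>2 / (2 * \<sigma>\<^sup>2))"
    using assms by (simp add: field_simps power2_eq_square)
  then show ?thesis
    using assms by (simp add: normal_density_shift[of \<sigma> x] normal_density_shift[of \<sigma> "x + l * \<sigma>\<^sup>2"]
        mult.left_commute flip: exp_add)
qed

lemma abs_gauss_density_eq:
  assumes "\<sigma> > 0"
  shows "abs_gauss_density \<sigma> l x y = exp (- (l\<^sup>2 * \<sigma>\<^sup>2 / 2)) / (2 * cosh (l * x)) *
     (cosh (l * y) * (normal_density x \<sigma> y + normal_density (- x) \<sigma> y))"
proof -
  have "normal_density x \<sigma> y + normal_density (- x) \<sigma> y
    = normal_density 0 \<sigma> y * exp (- x\<^sup>2 / (2 * \<sigma>\<^sup>2)) * (2 * cosh (x / \<sigma>\<^sup>2 * y))"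
  proof -
    have "exp (x / \<sigma>\<^sup>2 * y - x\<^sup>2 / (2 * \<sigma>\<^sup>2)) = exp (- x\<^sup>2 / (2 * \<sigma>\<^sup>2)) * exp (x / \<sigma>\<^sup>2 * y)"
      "exp (- x / \<sigma>\<^sup>2 * y - (- x)\<^sup>2 / (2 * \<sigma>\<^sup>2)) = exp (- x\<^sup>2 / (2 * \<sigma>\<^sup>2)) * exp (- (x / \<sigma>\<^sup>2 * y))"
      by (simp_all flip: exp_add)
    then show ?thesis
      unfolding normal_density_shift[OF assms, of x] normal_density_shift[OF assms, of "- x"] cosh_field_def
      by (simp only:) (simp add: algebra_simps)
  qed
  moreover have "exp (- x\<^sup>2 / (2 * \<sigma>\<^sup>2) - l\<^sup>2 * \<sigma>\<^sup>2 / 2)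
    = exp (- x\<^sup>2 / (2 * \<sigma>\<^sup>2)) * exp (- (l\<^sup>2 * \<sigma>\<^sup>2 / 2))"
    by (simp flip: exp_add)
  ultimately show ?thesis by (simp add: abs_gauss_density_def)
qed

text \<open>The function cosh(l y) is an eigenfunction of the centred Gaussian kernel with
  eigenvalue \<open>exp (l\<^sup>2 * \<sigma>\<^sup>2 / 2)\<close>, and the density is the
  corresponding Doob transform of the symmetrised kernel. The mass 1 is that of the whole line, half
  of it on each side of 0.\<close>

lemma has_bochner_integral_abs_gauss_density:
  assumes s: "\<sigma> > 0"
  shows "has_bochner_integral lborel (abs_gauss_density \<sigma> l x) 1"
proof -
  have n: "has_bochner_integral lborel (normal_density x \<sigma>) 1" for x
    using s by (simp add: has_bochner_integral_iff)
  have c: "has_bochner_integral lborel (\<lambda>y. cosh (l * y) * normal_density x \<sigma> y)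
      (exp (l\<^sup>2 * \<sigma>\<^sup>2 / 2) * cosh (l * x))" for x
  proof -
    have eq: "cosh (l * y) * normal_density x \<sigma> y
      = exp (l * x + l\<^sup>2 * \<sigma>\<^sup>2 / 2) / 2 * normal_density (x + l * \<sigma>\<^sup>2) \<sigma> y
      + exp (- l * x + l\<^sup>2 * \<sigma>\<^sup>2 / 2) / 2 * normal_density (x - l * \<sigma>\<^sup>2) \<sigma> y" for y
      using exp_times_normal_density[OF s, of l y x] exp_times_normal_density[OF s, of "- l" y x]
      by (simp add: cosh_field_def field_simps)
    have "has_bochner_integral lborel
      (\<lambda>y. exp (l * x + l\<^sup>2 * \<sigma>\<^sup>2 / 2) / 2 * normal_density (x + l * \<sigma>\<^sup>2) \<sigma> y
      + exp (- l * x + l\<^sup>2 * \<sigma>\<^sup>2 / 2) / 2 * normal_density (x - l * \<sigma>\<^sup>2) \<sigma> y)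
      (exp (l * x + l\<^sup>2 * \<sigma>\<^sup>2 / 2) / 2 * 1 + exp (- l * x + l\<^sup>2 * \<sigma>\<^sup>2 / 2) / 2 * 1)"
      by (intro has_bochner_integral_add has_bochner_integral_mult_right n)
    also have "exp (l * x + l\<^sup>2 * \<sigma>\<^sup>2 / 2) / 2 * 1 + exp (- l * x + l\<^sup>2 * \<sigma>\<^sup>2 / 2) / 2 * 1
        = exp (l\<^sup>2 * \<sigma>\<^sup>2 / 2) * cosh (l * x)"
      by (simp add: cosh_field_def algebra_simps flip: exp_add)
    finally show ?thesis unfolding eq .
  qed
  have "has_bochner_integral lborel (\<lambda>y. exp (- (l\<^sup>2 * \<sigma>\<^sup>2 / 2)) / (2 * cosh (l * x)) *
     (cosh (l * y) * normal_density x \<sigma> y + cosh (l * y) * normal_density (- x) \<sigma> y))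
     (exp (- (l\<^sup>2 * \<sigma>\<^sup>2 / 2)) / (2 * cosh (l * x)) *
       (exp (l\<^sup>2 * \<sigma>\<^sup>2 / 2) * cosh (l * x) + exp (l\<^sup>2 * \<sigma>\<^sup>2 / 2) * cosh (l * - x)))"
    by (intro has_bochner_integral_add has_bochner_integral_mult_right c)
  also have "(exp (- (l\<^sup>2 * \<sigma>\<^sup>2 / 2)) / (2 * cosh (l * x)) *
       (exp (l\<^sup>2 * \<sigma>\<^sup>2 / 2) * cosh (l * x) + exp (l\<^sup>2 * \<sigma>\<^sup>2 / 2) * cosh (l * - x))) = 1"
    by (simp add: exp_minus field_simps)
  also have "(\<lambda>y. exp (- (l\<^sup>2 * \<sigma>\<^sup>2 / 2)) / (2 * cosh (l * x)) *
     (cosh (l * y) * normal_density x \<sigma> y + cosh (l * y) * normal_density (- x) \<sigma> y))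
     = abs_gauss_density \<sigma> l x"
    by (intro ext) (simp add: abs_gauss_density_eq[OF s] distrib_left)
  finally show ?thesis .
qed

lemma abs_gauss_density_nonneg: "0 \<le> abs_gauss_density \<sigma> l x y"
  by (simp add: abs_gauss_density_def)

text \<open>The ratio of the two densities is a constant times a product of two cosh ratios, one
  from the drifts and one from the starting points, each increasing in \<bar>y\<bar>. So the density
  with the larger parameters can dominate only farther out.\<close>

lemma abs_gauss_density_single_crossing:
  assumes s: "\<sigma> > 0" and "\<bar>l\<bar> \<le> \<bar>l'\<bar>" "\<bar>x\<bar> \<le> \<bar>x'\<bar>"
    and y: "abs_gauss_density \<sigma> l' x' y \<le> abs_gauss_density \<sigma> l x y"
    and z: "abs_gauss_density \<sigma> l x z < abs_gauss_density \<sigma> l' x' z"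
  shows "\<bar>y\<bar> \<le> \<bar>z\<bar>"
proof (rule ccontr)
  assume "\<not> \<bar>y\<bar> \<le> \<bar>z\<bar>"
  then have zy: "\<bar>z\<bar> \<le> \<bar>y\<bar>" by simp
  define w where "w = (\<lambda>l x y. cosh (l * y) * cosh (x / \<sigma>\<^sup>2 * y))"
  define C where "C = (\<lambda>l x. exp (- x\<^sup>2 / (2 * \<sigma>\<^sup>2) - l\<^sup>2 * \<sigma>\<^sup>2 / 2) / cosh (l * x))"
  have C: "C l x > 0" and w: "w l x y > 0" for l x y by (simp_all add: C_def w_def)
  have D: "abs_gauss_density \<sigma> l x y = normal_density 0 \<sigma> y * (C l x * w l x y)" for l x y
    by (simp add: abs_gauss_density_def C_def w_def mult_ac)
  have n: "normal_density 0 \<sigma> y > 0" for y using s by (rule normal_density_pos)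
  have y': "C l' x' * w l' x' y \<le> C l x * w l x y" using y n[of y] by (simp add: D)
  have z': "C l x * w l x z < C l' x' * w l' x' z" using z n[of z] by (simp add: D)
  have "(cosh (l' * z) * cosh (l * y)) * (cosh (x' / \<sigma>\<^sup>2 * z) * cosh (x / \<sigma>\<^sup>2 * y))
    \<le> (cosh (l' * y) * cosh (l * z)) * (cosh (x' / \<sigma>\<^sup>2 * y) * cosh (x / \<sigma>\<^sup>2 * z))"
    using assms zy by (intro mult_mono cosh_ratio_mono) (auto simp: divide_right_mono)
  then have ratio: "w l' x' z * w l x y \<le> w l' x' y * w l x z"
    by (simp add: w_def mult_ac)
  have "C l x * w l x z * w l x y < C l' x' * w l' x' z * w l x y"
    using z' w by simp
  also have "\<dots> \<le> C l' x' * w l' x' y * w l x z"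
    using ratio C[of l' x'] by (simp add: mult.assoc)
  also have "\<dots> \<le> C l x * w l x y * w l x z"
    using y' w[of l x z] by simp
  finally show False by (simp add: mult_ac)
qed

lemma measurable_abs_gauss_density:
  "(\<lambda>z. abs_gauss_density \<sigma> l (fst z) (snd z)) \<in> borel_measurable (borel \<Otimes>\<^sub>M borel)"
proof -
  have [measurable]: "(cosh :: real \<Rightarrow> real) \<in> borel_measurable borel"
    by (intro borel_measurable_continuous_onI continuous_intros)
  show ?thesis unfolding abs_gauss_density_def by measurable
qed

text \<open>The start is not tested, as in \<open>killed_step\<close>. Integrating the even density
  over both signs keeps the recursion on the whole line.\<close>

fun abs_gauss_survival :: "real \<Rightarrow> real \<Rightarrow> real \<Rightarrow> nat \<Rightarrow> real \<Rightarrow> real" where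
  "abs_gauss_survival \<sigma> a l 0 x = 1"
| "abs_gauss_survival \<sigma> a l (Suc n) x =
     (\<integral>y. indicator {-a..a} y * abs_gauss_survival \<sigma> a l n y * abs_gauss_density \<sigma> l x y \<partial>lborel)"

lemma abs_gauss_survival_measurable: "abs_gauss_survival \<sigma> a l n \<in> borel_measurable borel"
proof (induction n)
  case 0
  have "abs_gauss_survival \<sigma> a l 0 = (\<lambda>_. 1)" by (intro ext) simp
  then show ?case by simp
next
  case (Suc n)
  note Suc[measurable] measurable_abs_gauss_density[measurable]
  have eq: "abs_gauss_survival \<sigma> a l (Suc n) = (\<lambda>x. \<integral>y. (\<lambda>z. indicator {-a..a} (snd z) *
      abs_gauss_survival \<sigma> a l n (snd z) * abs_gauss_density \<sigma> l (fst z) (snd z)) (x, y) \<partial>lborel)"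
    by (intro ext) simp
  show ?case unfolding eq
    by (intro lborel.borel_measurable_lebesgue_integral) (simp add: split_def)
qed

lemma abs_gauss_survival_bounds:
  assumes s: "\<sigma> > 0"
  shows "0 \<le> abs_gauss_survival \<sigma> a l n x" "abs_gauss_survival \<sigma> a l n x \<le> 1"
proof -
  have "0 \<le> abs_gauss_survival \<sigma> a l n x \<and> abs_gauss_survival \<sigma> a l n x \<le> 1"
  proof (induction n arbitrary: x)
    case (Suc n)
    note d = has_bochner_integral_abs_gauss_density[OF s, of l x, unfolded has_bochner_integral_iff]
    have "abs_gauss_survival \<sigma> a l (Suc n) x \<le> (\<integral>y. abs_gauss_density \<sigma> l x y \<partial>lborel)"
      using d Suc abs_gauss_survival_measurable[of \<sigma> a l n] abs_gauss_density_nonneg[of \<sigma> l x]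
      unfolding abs_gauss_survival.simps
      by (intro integral_mono integrable_mult_bounded) (auto simp: indicator_def intro: mult_left_le_one_le)
    moreover have "0 \<le> abs_gauss_survival \<sigma> a l (Suc n) x"
      using Suc by (auto intro!: Bochner_Integration.integral_nonneg mult_nonneg_nonneg abs_gauss_density_nonneg)
    ultimately show ?case using d by simp
  qed simp
  then show "0 \<le> abs_gauss_survival \<sigma> a l n x" "abs_gauss_survival \<sigma> a l n x \<le> 1" by auto
qed

text \<open>Drift and start are raised in a single induction. The survival function is exchanged
  first, under the density for \<open>l'\<close> and \<open>x'\<close>; exchanging the density by
  single crossing then requires survival for \<open>l\<close> to decrease in \<bar>y\<bar>, which is
  the induction hypothesis with equal drifts.\<close>

lemma abs_gauss_survival_antimono:
  assumes s: "\<sigma> > 0" and "\<bar>l\<bar> \<le> \<bar>l'\<bar>" "\<bar>x\<bar> \<le> \<bar>x'\<bar>"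
  shows "abs_gauss_survival \<sigma> a l' n x' \<le> abs_gauss_survival \<sigma> a l n x"
  using assms(2,3)
proof (induction n arbitrary: l l' x x')
  case (Suc n)
  define F where "F = (\<lambda>l y. indicator {-a..a} y * abs_gauss_survival \<sigma> a l n y)"
  have F: "F l \<in> borel_measurable lborel" "0 \<le> F l y" "F l y \<le> 1" for l y
    using abs_gauss_survival_measurable[of \<sigma> a l n] abs_gauss_survival_bounds[OF s, of a l n y]
    by (auto simp: F_def indicator_def)
  note d = has_bochner_integral_abs_gauss_density[OF s, unfolded has_bochner_integral_iff]
  have "(\<integral>y. F l' y * abs_gauss_density \<sigma> l' x' y \<partial>lborel) \<le> (\<integral>y. F l y * abs_gauss_density \<sigma> l' x' y \<partial>lborel)"
    using F d Suc.IH[OF Suc.prems(1)]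
    by (intro integral_mono integrable_mult_bounded mult_right_mono abs_gauss_density_nonneg)
       (auto simp: F_def indicator_def)
  also have "\<dots> \<le> (\<integral>y. F l y * abs_gauss_density \<sigma> l x y \<partial>lborel)"
  proof (rule integral_le_single_crossing)
    fix y z assume "abs_gauss_density \<sigma> l' x' y \<le> abs_gauss_density \<sigma> l x y"
      and "abs_gauss_density \<sigma> l x z < abs_gauss_density \<sigma> l' x' z"
    then have "\<bar>y\<bar> \<le> \<bar>z\<bar>" using abs_gauss_density_single_crossing[OF s Suc.prems] by blast
    then show "F l z \<le> F l y"
      using Suc.IH[of l l y z] abs_gauss_survival_bounds[OF s, of a l n y]
      by (auto simp: F_def indicator_def)
  qed (use F d in auto)
  finally show ?case by (simp add: F_def)
qed simp

section \<open>From the signed Gaussian walk to its absolute value\<close>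

lemma killed_step_normal:
  assumes s: "\<sigma> > 0" and [measurable]: "A \<in> sets borel" "f \<in> borel_measurable borel"
  shows "killed_step (density lborel (normal_density m \<sigma>)) A f x
    = (\<integral>\<^sup>+y. indicator A y * f y * ennreal (normal_density (x + m) \<sigma> y) \<partial>lborel)"
proof -
  have "killed_step (density lborel (normal_density m \<sigma>)) A f x
    = (\<integral>\<^sup>+y. ennreal (normal_density m \<sigma> y) * (indicator A (x + y) * f (x + y)) \<partial>lborel)"
    unfolding killed_step_def by (subst nn_integral_density) auto
  also have "\<dots> = (\<integral>\<^sup>+y. indicator A y * f y * ennreal (normal_density (x + m) \<sigma> y) \<partial>lborel)"
    by (subst (2) nn_integral_real_affine[where c=1 and t=x])
       (auto simp: normal_density_def algebra_simps)
  finally show ?thesis .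
qed

lemma killed_step_normal_measurable:
  assumes [measurable]: "A \<in> sets borel" "f \<in> borel_measurable borel"
  shows "killed_step (density lborel (normal_density m \<sigma>)) A f \<in> borel_measurable borel"
proof -
  have "(\<lambda>x. \<integral>\<^sup>+y. ennreal (normal_density m \<sigma> y) * (indicator A (x + y) * f (x + y)) \<partial>lborel) \<in> borel_measurable borel"
    by measurable
  then show ?thesis
    unfolding killed_step_def by (subst nn_integral_density) auto
qed

text \<open>
  Tilting the density by \<open>exp (l * y)\<close> removes the drift; folding the line at the origin then
  produces the chain of absolute values.
\<close>

lemma killed_gauss_walk_eq:
  fixes \<sigma> a l :: real
  assumes s: "\<sigma> > 0"
  defines "G \<equiv> \<lambda>n. (killed_step (density lborel (normal_density (l * \<sigma>\<^sup>2) \<sigma>)) {-a..a} ^^ n) (\<lambda>_. 1)"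
  shows "ennreal (exp (l * x)) * G n x + ennreal (exp (- l * x)) * G n (- x)
    = ennreal (2 * cosh (l * x) * abs_gauss_survival \<sigma> a l n x)"
proof (induction n arbitrary: x)
  case 0
  show ?case by (simp add: G_def cosh_field_def flip: ennreal_plus)
next
  case (Suc n)
  let ?A = "{-a..a}"
  define c where "c = exp (- (l\<^sup>2 * \<sigma>\<^sup>2 / 2))"
  have c: "c > 0" by (simp add: c_def)
  have half: "ennreal (1/2) * 2 = 1" using ennreal_mult[of "1/2" 2] by simp
  have half_c: "ennreal (c / 2) = ennreal c * ennreal (1/2)"
    using c ennreal_mult[of c "1/2"] by simp
  define h where "h = (\<lambda>y. normal_density x \<sigma> y + normal_density (- x) \<sigma> y)"
  have h0: "h y \<ge> 0" for y by (simp add: h_def)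
  have hm[measurable]: "h \<in> borel_measurable borel" by (simp add: h_def)
  have Gm[measurable]: "G n \<in> borel_measurable borel" for n
    unfolding G_def by (induction n) (auto intro: killed_step_normal_measurable)
  define K where "K = (\<lambda>y. indicator ?A y * abs_gauss_survival \<sigma> a l n y)"
  have Km[measurable]: "K \<in> borel_measurable borel"
    unfolding K_def using abs_gauss_survival_measurable[of \<sigma> a l n] by measurable
  have K: "K \<in> borel_measurable lborel" "0 \<le> K y" "K y \<le> 1" for y
    using abs_gauss_survival_bounds[OF s, of a l n y] by (simp, auto simp: K_def indicator_def)
  have coshm[measurable]: "(cosh :: real \<Rightarrow> real) \<in> borel_measurable borel"
    by (intro borel_measurable_continuous_onI continuous_intros)
  note d = has_bochner_integral_abs_gauss_density[OF s, of l x, unfolded has_bochner_integral_iff]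
  define T where "T = (\<lambda>y. indicator ?A y * (ennreal (exp (l * y)) * G n y) * ennreal (h y))"
  have Tm[measurable]: "T \<in> borel_measurable borel" unfolding T_def by measurable
  have step: "G (Suc n) x = (\<integral>\<^sup>+y. indicator ?A y * G n y * ennreal (normal_density (x + l * \<sigma>\<^sup>2) \<sigma> y) \<partial>lborel)" for x
    using killed_step_normal[OF s _ Gm, of ?A] by (simp add: G_def)
  have tilt: "exp (l * x) * normal_density (x + l * \<sigma>\<^sup>2) \<sigma> y = c * (exp (l * y) * normal_density x \<sigma> y)" for x y
    unfolding exp_times_normal_density[OF s] by (simp add: c_def exp_add exp_minus)
  have tilt': "ennreal (exp (l * x)) * G (Suc n) x =
      (\<integral>\<^sup>+y. indicator ?A y * G n y * ennreal (c * (exp (l * y) * normal_density x \<sigma> y)) \<partial>lborel)" for x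
    unfolding step tilt[symmetric]
    by (subst nn_integral_cmult[symmetric]) (auto simp: ennreal_mult mult_ac)
  have "ennreal (exp (l * x)) * G (Suc n) x + ennreal (exp (- l * x)) * G (Suc n) (- x)
    = (\<integral>\<^sup>+y. indicator ?A y * G n y * ennreal (c * (exp (l * y) * normal_density x \<sigma> y)) +
        indicator ?A y * G n y * ennreal (c * (exp (l * y) * normal_density (- x) \<sigma> y)) \<partial>lborel)"
    using tilt'[of x] tilt'[of "- x"] by (subst nn_integral_add) auto
  also have "\<dots> = (\<integral>\<^sup>+y. ennreal c * T y \<partial>lborel)"
    using c by (intro nn_integral_cong)
       (simp add: T_def h_def ennreal_mult distrib_left distrib_right mult_ac)
  also have "\<dots> = ennreal c * (\<integral>\<^sup>+y. T y \<partial>lborel)"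
    by (rule nn_integral_cmult) simp
  \<comment> \<open>Averaging \<open>T\<close> with its reflection brings \<open>G n y\<close> and
    \<open>G n (- y)\<close> together with the weights of the induction hypothesis; this is the
    folding.\<close>
  also have "(\<integral>\<^sup>+y. T y \<partial>lborel) = ennreal (1/2) * (\<integral>\<^sup>+y. T y + T (- y) \<partial>lborel)"
  proof -
    have "(\<integral>\<^sup>+y. T y + T (- y) \<partial>lborel) = (\<integral>\<^sup>+y. T y \<partial>lborel) + (\<integral>\<^sup>+y. T (- y) \<partial>lborel)"
      by (rule nn_integral_add) auto
    also have "(\<integral>\<^sup>+y. T (- y) \<partial>lborel) = (\<integral>\<^sup>+y. T y \<partial>lborel)"
      by (subst (2) nn_integral_real_affine[where c="-1" and t=0]) auto
    finally show ?thesis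
      using half by (simp add: mult.assoc[symmetric] flip: mult_2)
  qed
  also have "(\<integral>\<^sup>+y. T y + T (- y) \<partial>lborel) = (\<integral>\<^sup>+y. ennreal (2 * (K y * (cosh (l * y) * h y))) \<partial>lborel)"
  proof (intro nn_integral_cong)
    fix y
    have "indicator ?A (- y) = (indicator ?A y :: ennreal)" by (auto simp: indicator_def)
    moreover have "h (- y) = h y" by (simp add: h_def normal_density_def power2_commute add.commute)
    ultimately have "T y + T (- y) = indicator ?A y *
        (ennreal (exp (l * y)) * G n y + ennreal (exp (- l * y)) * G n (- y)) * ennreal (h y)"
      by (simp add: T_def distrib_left distrib_right)
    also have "\<dots> = ennreal (2 * (K y * (cosh (l * y) * h y)))"
      unfolding Suc.IH using abs_gauss_survival_bounds(1)[OF s, of a l n y] h0[of y]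
      by (simp add: K_def indicator_def mult_ac flip: ennreal_mult)
    finally show "T y + T (- y) = \<dots>" .
  qed
  also have "ennreal c * (ennreal (1/2) * \<dots>) = (\<integral>\<^sup>+y. ennreal (c / 2) * ennreal (2 * (K y * (cosh (l * y) * h y))) \<partial>lborel)"
    unfolding half_c by (subst nn_integral_cmult) (measurable, simp only: mult.assoc)
  also have "\<dots> = (\<integral>\<^sup>+y. ennreal (2 * cosh (l * x) * (K y * abs_gauss_density \<sigma> l x y)) \<partial>lborel)"
    using c h0 K by (intro nn_integral_cong)
      (simp add: abs_gauss_density_eq[OF s] c_def h_def flip: ennreal_mult)
  also have "\<dots> = ennreal (\<integral>y. 2 * cosh (l * x) * (K y * abs_gauss_density \<sigma> l x y) \<partial>lborel)"
    using K d by (intro nn_integral_eq_integral integrable_mult_right integrable_mult_bounded AE_I2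
        mult_nonneg_nonneg abs_gauss_density_nonneg) auto
  also have "\<dots> = ennreal (2 * cosh (l * x) * abs_gauss_survival \<sigma> a l (Suc n) x)"
    by (simp add: K_def)
  finally show ?case .
qed

subsection \<open>Brownian motion with drift\<close>

lemma killed_gauss_walk_at_origin:
  assumes s: "\<sigma> > 0"
  shows "(killed_step (density lborel (normal_density (l * \<sigma>\<^sup>2) \<sigma>)) {-a..a} ^^ n) (\<lambda>_. 1) 0
    = ennreal (abs_gauss_survival \<sigma> a l n 0)" (is "?G = ennreal ?H")
proof -
  have "2 * ?G = 2 * ennreal ?H"
    using killed_gauss_walk_eq[OF s, of l 0 n a] abs_gauss_survival_bounds(1)[OF s, of a l n 0]
    by (simp add: ennreal_mult flip: mult_2)
  then show ?thesis by (simp add: ennreal_mult_cancel_left)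
qed

text \<open>Over a mesh \<open>d\<close> the drifted increment has mean \<open>l * d\<close> and
  variance \<open>d\<close>, so \<open>\<sigma> = sqrt d\<close> gives the required mean
  \<open>l * \<sigma>\<^sup>2\<close>. The factor \<open>indicator {-a..a} 0\<close> tests the start
  and covers negative \<open>a\<close>, where both sides are 0.\<close>

lemma brownian_grid_measure:
  assumes B: "standard_brownian_motion M B" and d: "d > 0"
  shows "{\<omega>\<in>space M. \<forall>i\<le>n. B (real i * d) \<omega> + l * (real i * d) \<in> {-a..a}} \<in> sets M" (is "?D \<in> _")
    and "measure M {\<omega>\<in>space M. \<forall>i\<le>n. B (real i * d) \<omega> + l * (real i * d) \<in> {-a..a}}
      = indicator {-a..a} 0 * abs_gauss_survival (sqrt d) a l n 0"
proof -
  interpret prob_space M using B by (simp add: standard_brownian_motion_def)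
  have meas: "B (real i * d) \<in> borel_measurable M" for i :: nat
    using B d by (simp add: standard_brownian_motion_def)
  have "{\<omega>\<in>space M. B (real i * d) \<omega> + l * (real i * d) \<in> {-a..a}} \<in> sets M" for i :: nat
    using meas[of i] by measurable
  then show D: "?D \<in> sets M"
    using sets.sets_Collect_finite_All[of "{..n}" M "\<lambda>i \<omega>. B (real i * d) \<omega> + l * (real i * d) \<in> {-a..a}"]
    by (simp only: Ball_def atMost_iff finite_atMost)
  \<comment> \<open>The factor 1 matches the affine form of
    \<open>normal_density_affine\<close>.\<close>
  define Y where "Y = (\<lambda>i \<omega>. l * d + 1 * (B (real (Suc i) * d) \<omega> - B (real i * d) \<omega>))"
  define \<nu> where "\<nu> = density lborel (normal_density (l * d) (sqrt d))"
  have "indep_vars (\<lambda>_. borel) (\<lambda>i \<omega>. B (real (Suc i) * d) \<omega> - B (real i * d) \<omega>) {..<n}"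
    using B d unfolding standard_brownian_motion_def
    by (elim conjE allE[of _ n] allE[of _ "\<lambda>i. real i * d"]) (auto simp: mono_def mult_right_mono)
  then have indep: "indep_vars (\<lambda>_. borel) Y {..<n}"
    unfolding Y_def by (rule indep_vars_compose2) auto
  have distr: "distr M borel (Y i) = \<nu>" for i
  proof -
    have "distributed M lborel (\<lambda>\<omega>. B (real (Suc i) * d) \<omega> - B (real i * d) \<omega>)
        (normal_density 0 (sqrt (real (Suc i) * d - real i * d)))"
      using B d by (simp add: standard_brownian_motion_def)
    then have "distributed M lborel (\<lambda>\<omega>. B (real (Suc i) * d) \<omega> - B (real i * d) \<omega>)
        (normal_density 0 (sqrt d))"
      by (simp add: algebra_simps)
    from normal_density_affine[OF this, of 1 "l * d"] d
    have "distributed M lborel (Y i) (normal_density (l * d) (sqrt d))"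
      by (simp add: Y_def)
    then have "distr M lborel (Y i) = \<nu>" unfolding \<nu>_def by (rule distributed_distr_eq_density)
    moreover have "distr M borel (Y i) = distr M lborel (Y i)" by (rule distr_cong) auto
    ultimately show ?thesis by simp
  qed
  \<comment> \<open>\<open>B 0\<close> vanishes only almost surely, so these sums agree with the
    grid values only up to a null set.\<close>
  have sumY: "(\<Sum>j<i. Y j \<omega>) = B (real i * d) \<omega> - B 0 \<omega> + l * (real i * d)" for i \<omega>
    by (induction i) (auto simp: Y_def algebra_simps)
  have N: "space (borel :: real measure) = UNIV"
    "(\<lambda>z. fst z + snd z) \<in> borel \<Otimes>\<^sub>M borel \<rightarrow>\<^sub>M (borel :: real measure)"
    "{-a..a} \<in> sets borel" by auto
  note walk = emeasure_killed_walk[OF N indep distr]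
  have "measure M ?D = measure M {\<omega>\<in>space M. \<forall>i\<le>n. (\<Sum>j<i. Y j \<omega>) \<in> {-a..a}}"
  proof (rule measure_eq_AE[OF _ D walk(1)])
    have "AE \<omega> in M. B 0 \<omega> = 0" using B by (simp add: standard_brownian_motion_def)
    then show "AE \<omega> in M. (\<omega> \<in> ?D) = (\<omega> \<in> {\<omega>\<in>space M. \<forall>i\<le>n. (\<Sum>j<i. Y j \<omega>) \<in> {-a..a}})"
      by eventually_elim (simp add: sumY)
  qed
  also have "\<dots> = enn2real (indicator {-a..a} 0 * (killed_step \<nu> {-a..a} ^^ n) (\<lambda>_. 1) 0)"
    unfolding measure_def walk(2) ..
  also have "\<dots> = indicator {-a..a} 0 * abs_gauss_survival (sqrt d) a l n 0"
    using killed_gauss_walk_at_origin[of "sqrt d" n l a] abs_gauss_survival_bounds(1)[of "sqrt d" a l n 0] d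
    by (simp add: \<nu>_def indicator_def)
  finally show "measure M ?D = \<dots>" .
qed

section \<open>Exit times of continuous paths and dyadic grids\<close>

lemma first_exit_gt_iff:
  fixes x :: "real \<Rightarrow> real"
  assumes x: "continuous_on {0..} x" and t: "t > 0"
  shows "ereal t < Inf (ereal ` {s. 0 \<le> s \<and> x s \<notin> {-b<..<b}}) \<longleftrightarrow> (\<forall>s\<in>{0..t}. x s \<in> {-b<..<b})"
proof
  assume *: "ereal t < Inf (ereal ` {s. 0 \<le> s \<and> x s \<notin> {-b<..<b}})"
  show "\<forall>s\<in>{0..t}. x s \<in> {-b<..<b}"
  proof (rule ballI, rule ccontr)
    fix s assume "s \<in> {0..t}" "x s \<notin> {-b<..<b}"
    then have "Inf (ereal ` {s. 0 \<le> s \<and> x s \<notin> {-b<..<b}}) \<le> ereal s"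
      by (intro Inf_lower imageI) simp
    also have "\<dots> \<le> ereal t" using \<open>s \<in> {0..t}\<close> by simp
    finally show False using * by simp
  qed
next
  assume *: "\<forall>s\<in>{0..t}. x s \<in> {-b<..<b}"
  \<comment> \<open>The strict inequality asks for a margin beyond \<open>t\<close>: the interval is
    open and the path is continuous at the interior time \<open>t\<close>, so no exit occurs before
    some \<open>t + e\<close>.\<close>
  have "isCont x t"
    using continuous_on_subset[OF x, of "{0<..}"] t
    by (simp add: continuous_on_eq_continuous_at subset_eq)
  then have "eventually (\<lambda>s. x s \<in> {-b<..<b}) (at t)"
    using * t unfolding isCont_def by (intro topological_tendstoD) auto
  then obtain e where e: "e > 0" "\<And>s. s \<noteq> t \<Longrightarrow> dist s t < e \<Longrightarrow> x s \<in> {-b<..<b}"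
    unfolding eventually_at by auto
  have "ereal (t + e) \<le> Inf (ereal ` {s. 0 \<le> s \<and> x s \<notin> {-b<..<b}})"
  proof (intro Inf_greatest, clarify)
    fix s assume s: "0 \<le> s" "x s \<notin> {-b<..<b}"
    then have "s > t" using * by (auto simp: not_le[symmetric])
    moreover from this have "\<not> dist s t < e" using s(2) e(2)[of s] by auto
    ultimately show "ereal (t + e) \<le> ereal s" by (simp add: dist_real_def)
  qed
  moreover have "ereal t < ereal (t + e)" using e by simp
  ultimately show "ereal t < Inf (ereal ` {s. 0 \<le> s \<and> x s \<notin> {-b<..<b}})" by (rule less_le_trans[rotated])
qed

text \<open>
  Passing to the slightly smaller closed intervals avoids having to show that hitting a level
  without crossing it is a null event.
\<close>

lemma confined_iff_dyadic:
  fixes x :: "real \<Rightarrow> real"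
  assumes x: "continuous_on {0..} x" and t: "t > 0"
  shows "(\<forall>s\<in>{0..t}. x s \<in> {-b<..<b}) \<longleftrightarrow>
    (\<exists>j. \<forall>N. \<forall>i\<le>2 ^ N. x (real i * (t / 2 ^ N)) \<in> {-(b - 1 / real (Suc j))..b - 1 / real (Suc j)})"
proof
  assume *: "\<forall>s\<in>{0..t}. x s \<in> {-b<..<b}"
  have "continuous_on {0..t} (\<lambda>s. \<bar>x s\<bar>)"
    using continuous_on_subset[OF x, of "{0..t}"] by (intro continuous_intros) auto
  \<comment> \<open>The maximum of the absolute value over the compact time interval is attained,
    hence stays below \<open>b\<close> by a positive gap, which determines \<open>j\<close>.\<close>
  then obtain u where u: "u \<in> {0..t}" "\<And>s. s \<in> {0..t} \<Longrightarrow> \<bar>x s\<bar> \<le> \<bar>x u\<bar>"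
    using continuous_attains_sup[of "{0..t}" "\<lambda>s. \<bar>x s\<bar>"] t by auto
  have "\<bar>x u\<bar> < b" using bspec[OF * u(1)] by (simp add: abs_less_iff)
  then obtain j where j: "1 / real (Suc j) < b - \<bar>x u\<bar>"
    using nat_approx_posE[of "b - \<bar>x u\<bar>"] by auto
  show "\<exists>j. \<forall>N. \<forall>i\<le>2 ^ N. x (real i * (t / 2 ^ N)) \<in> {-(b - 1 / real (Suc j))..b - 1 / real (Suc j)}"
  proof (intro exI allI impI)
    fix N i :: nat assume "i \<le> 2 ^ N"
    then have "real i \<le> 2 ^ N" by (metis of_nat_le_iff of_nat_numeral of_nat_power)
    then have "real i * (t / 2 ^ N) \<in> {0..t}" using t by (simp add: field_simps)
    from u(2)[OF this] j show "x (real i * (t / 2 ^ N)) \<in> {-(b - 1 / real (Suc j))..b - 1 / real (Suc j)}"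
      by (auto simp: abs_if split: if_splits)
  qed
next
  assume "\<exists>j. \<forall>N. \<forall>i\<le>2 ^ N. x (real i * (t / 2 ^ N)) \<in> {-(b - 1 / real (Suc j))..b - 1 / real (Suc j)}"
  then obtain j where j: "\<And>N i. i \<le> 2 ^ N \<Longrightarrow> x (real i * (t / 2 ^ N)) \<in> {-(b - 1 / real (Suc j))..b - 1 / real (Suc j)}"
    by blast
  show "\<forall>s\<in>{0..t}. x s \<in> {-b<..<b}"
  proof
    fix s assume s: "s \<in> {0..t}"
    \<comment> \<open>Index of the last grid point of level \<open>N\<close> not after
      \<open>s\<close>; its distance from \<open>s\<close> is at most one mesh width
      \<open>t / 2 ^ N\<close>.\<close>
    define i where "i = (\<lambda>N::nat. nat \<lfloor>2 ^ N * (s / t)\<rfloor>)"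
    have i: "real (i N) \<le> 2 ^ N * (s / t)" "2 ^ N * (s / t) \<le> real (i N) + 1" for N
    proof -
      have "0 \<le> 2 ^ N * (s / t)" using s t by auto
      then have "real (i N) = of_int \<lfloor>2 ^ N * (s / t)\<rfloor>" by (simp add: i_def)
      then show "real (i N) \<le> 2 ^ N * (s / t)" "2 ^ N * (s / t) \<le> real (i N) + 1" by linarith+
    qed
    have iN: "i N \<le> 2 ^ N" for N
    proof -
      note i(1)[of N]
      also have "2 ^ N * (s / t) \<le> 2 ^ N * 1" using s t by (intro mult_left_mono) auto
      also have "2 ^ N * 1 = real (2 ^ N)" by simp
      finally have "real (i N) \<le> real (2 ^ N)" .
      then show ?thesis by (simp only: of_nat_le_iff)
    qed
    have s_eq: "2 ^ N * (s / t) * (t / 2 ^ N) = s" for N using t by simp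
    have le: "real (i N) * (t / 2 ^ N) \<le> s" "s \<le> real (i N) * (t / 2 ^ N) + t / 2 ^ N" for N
      using mult_right_mono[OF i(1)[of N], of "t / 2 ^ N"] mult_right_mono[OF i(2)[of N], of "t / 2 ^ N"] t
      unfolding s_eq by (auto simp: distrib_right add_divide_distrib)
    have lim: "(\<lambda>N. real (i N) * (t / 2 ^ N)) \<longlonglongrightarrow> s"
    proof (rule tendsto_sandwich)
      have "(\<lambda>N. t / 2 ^ N) \<longlonglongrightarrow> 0" by real_asymp
      from tendsto_diff[OF tendsto_const this, of s]
      show "(\<lambda>N. s - t / 2 ^ N) \<longlonglongrightarrow> s" by simp
      show "\<forall>\<^sub>F N in sequentially. s - t / 2 ^ N \<le> real (i N) * (t / 2 ^ N)"
        using le(2) by (intro always_eventually) (simp add: diff_le_eq)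
      show "\<forall>\<^sub>F N in sequentially. real (i N) * (t / 2 ^ N) \<le> s"
        using le(1) by (intro always_eventually) simp
    qed simp
    have "(\<lambda>N. x (real (i N) * (t / 2 ^ N))) \<longlonglongrightarrow> x s"
      using s t by (intro continuous_on_tendsto_compose[OF x lim]) auto
    then have "x s \<in> {-(b - 1 / real (Suc j))..b - 1 / real (Suc j)}"
      by (rule closed_sequentially[OF closed_atLeastAtMost j[OF iN]])
    moreover have "0 < 1 / real (Suc j)" by simp
    ultimately show "x s \<in> {-b<..<b}"
      unfolding atLeastAtMost_iff greaterThanLessThan_iff by linarith
  qed
qed

text \<open>The survival event is replaced, up to a null set, by the measurable event
  \<open>U l\<close>, obtained from grid events by a decreasing limit in \<open>N\<close> and an
  increasing one in \<open>j\<close>. Both limits preserve the inequality between drifts.\<close>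

lemma exit_survival_antimono:
  assumes B: "standard_brownian_motion M B" and t: "t > 0"
  shows "antimono_on {0..} (\<lambda>l. exit_survival M B b t l)"
proof -
  interpret prob_space M using B by (simp add: standard_brownian_motion_def)
  \<comment> \<open>Half-widths increasing to \<open>b\<close>. The first ones may be negative, in
    which case the grid events are empty.\<close>
  define a where "a = (\<lambda>j. b - 1 / real (Suc j))"
  define D where "D = (\<lambda>l j N. {\<omega>\<in>space M. \<forall>i\<le>2 ^ N. B (real i * (t / 2 ^ N)) \<omega> + l * (real i * (t / 2 ^ N)) \<in> {-a j..a j}})"
  have d: "t / 2 ^ N > 0" for N using t by simp
  have D: "D l j N \<in> sets M" for l j N
    unfolding D_def by (rule brownian_grid_measure[OF B d])
  have D_mono: "measure M (D l' j N) \<le> measure M (D l j N)" if "0 \<le> l" "l \<le> l'" for l l' j N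
    unfolding D_def brownian_grid_measure(2)[OF B d]
    using that t by (intro mult_left_mono abs_gauss_survival_antimono) auto
  define E where "E = (\<lambda>l j. \<Inter>N. D l j N)"
  define U where "U = (\<lambda>l. \<Union>j. E l j)"
  have E: "E l j \<in> sets M" for l j using D by (auto simp: E_def)
  have U: "U l \<in> sets M" for l using E by (auto simp: U_def)
  \<comment> \<open>Refining the grid only adds constraints, since point \<open>i\<close> of level
    \<open>N\<close> is point \<open>2 * i\<close> of level \<open>Suc N\<close>.\<close>
  have dec: "decseq (D l j)" for l j
  proof (rule decseq_SucI, rule subsetI)
    fix N \<omega> assume \<omega>: "\<omega> \<in> D l j (Suc N)"
    show "\<omega> \<in> D l j N"
      unfolding D_def
    proof (rule CollectI, intro conjI allI impI)
      show "\<omega> \<in> space M" using \<omega> by (simp add: D_def)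
      fix i :: nat assume "i \<le> 2 ^ N"
      then have "2 * i \<le> 2 ^ Suc N" by simp
      with \<omega> have "B (real (2 * i) * (t / 2 ^ Suc N)) \<omega> + l * (real (2 * i) * (t / 2 ^ Suc N)) \<in> {-a j..a j}"
        unfolding D_def by blast
      moreover have "real (2 * i) * (t / 2 ^ Suc N) = real i * (t / 2 ^ N)" by simp
      ultimately show "B (real i * (t / 2 ^ N)) \<omega> + l * (real i * (t / 2 ^ N)) \<in> {-a j..a j}" by (simp only:)
    qed
  qed
  have a: "a j \<le> a (Suc j)" for j by (simp add: a_def field_simps)
  have inc: "incseq (E l)" for l
  proof (rule incseq_SucI)
    fix j show "E l j \<subseteq> E l (Suc j)"
      using a[of j] unfolding E_def D_def by fastforce
  qed
  have limD: "(\<lambda>N. measure M (D l j N)) \<longlonglongrightarrow> measure M (E l j)" for l j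
    unfolding E_def using D dec by (intro finite_Lim_measure_decseq) auto
  have limE: "(\<lambda>j. measure M (E l j)) \<longlonglongrightarrow> measure M (U l)" for l
    unfolding U_def using E inc by (intro finite_Lim_measure_incseq) auto
  have surv: "exit_survival M B b t l = measure M (U l)" for l
  proof -
    let ?S = "{\<omega> \<in> space M. drift_exit_time B l b \<omega> > ereal t}"
    have "AE \<omega> in M. continuous_on {0..} (\<lambda>t. B t \<omega>)"
      using B by (simp add: standard_brownian_motion_def)
    then have "AE \<omega> in M. \<omega> \<in> U l \<longleftrightarrow> \<omega> \<in> ?S"
      using AE_space
    proof eventually_elim
      case (elim \<omega>)
      define x where "x = (\<lambda>s. B s \<omega> + l * s)"
      have x: "continuous_on {0..} x"
        unfolding x_def using elim(1) by (intro continuous_intros)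
      have "\<omega> \<in> ?S \<longleftrightarrow> ereal t < Inf (ereal ` {s. 0 \<le> s \<and> x s \<notin> {-b<..<b}})"
        using elim by (simp add: drift_exit_time_def x_def)
      also have "\<dots> \<longleftrightarrow> \<omega> \<in> U l"
        unfolding first_exit_gt_iff[OF x t] confined_iff_dyadic[OF x t]
        using elim by (auto simp: U_def E_def D_def a_def x_def)
      finally show ?case by simp
    qed
    then have ae: "AE \<omega> in completion M. \<omega> \<in> U l \<longleftrightarrow> \<omega> \<in> ?S"
      by (rule AE_completion)
    \<comment> \<open>Almost sure equality with \<open>U l\<close> is what makes the exit event
      measurable, and this only in the completion.\<close>
    have "?S \<in> sets (completion M)"
      using U by (intro completion.in_sets_AE[OF ae]) auto
    then have "measure (completion M) ?S = measure (completion M) (U l)"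
      using ae U by (intro measure_eq_AE) (auto elim: eventually_mono)
    then show ?thesis
      using U by (simp add: exit_survival_def)
  qed
  show ?thesis
  proof (intro monotone_onI)
    fix l l' :: real assume "l \<in> {0..}" "l' \<in> {0..}" "l \<le> l'"
    then have "measure M (D l' j N) \<le> measure M (D l j N)" for j N
      by (intro D_mono) auto
    then have "measure M (E l' j) \<le> measure M (E l j)" for j
      by (intro LIMSEQ_le[OF limD limD]) auto
    then have "measure M (U l') \<le> measure M (U l)"
      by (intro LIMSEQ_le[OF limE limE]) auto
    then show "exit_survival M B b t l' \<le> exit_survival M B b t l"
      by (simp only: surv)
  qed
qed

theorem theorem1:
  shows "(\<forall>(k::nat) (n::nat) (M :: real \<Rightarrow> 'a measure) (S :: real \<Rightarrow> nat \<Rightarrow> 'a \<Rightarrow> int).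
            k > 0 \<longrightarrow> (\<forall>p\<in>{0<..<1}. simple_random_walk (M p) p (S p)) \<longrightarrow>
              mono_on {0<..1/2}
                (\<lambda>p. measure (M p) {\<omega> \<in> space (M p). walk_hitting_time (S p) k \<omega> > enat n}) \<and>
              antimono_on {1/2..<1}
                (\<lambda>p. measure (M p) {\<omega> \<in> space (M p). walk_hitting_time (S p) k \<omega> > enat n})) \<and>
         (\<forall>(M :: 'b measure) (B :: real \<Rightarrow> 'b \<Rightarrow> real) (b::real) (t::real).
            standard_brownian_motion M B \<longrightarrow> b > 0 \<longrightarrow> t > 0 \<longrightarrow>
              antimono_on {0..} (\<lambda>l. exit_survival M B b t l))"
  by (intro conjI allI impI walk_hitting_time_monotone exit_survival_antimono)

end
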